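(* Let $m$ be a divisor of $n$, let $\xi$ be a primitive element of $\mathbb{F}_{2^n}$, and let $g=(2^n-1)/(2^m-1)$. The following are equivalent: (i) there exists a group divisible triangle design $(V,\mathcal{G},\mathcal{B})$ of order $n$ with groups of dimension $m$ over $\mathbb{F}_2$, where $V=\mathbb{F}_{2^n}$, $\mathcal{G}$ is the Desarguesian spread $\{a\mathbb{F}_{2^m}: a\in\mathbb{F}_{2^n}^*\}$ (the multiplicative cosets of the subfield $\mathbb{F}_{2^m}$), and $\mathcal{B}$ is invariant under the action of the multiplicative group $\mathbb{F}_{2^n}^*$ (any such design being balanced); (ii) there exists a partition of $\mathbb{Z}_{2^n-1}\setminus g\mathbb{Z}_{2^n-1}$ into $18$-element subsets of the form $\Gamma(k_1)\,\dot\cup\,\Gamma(k_2)\,\dot\cup\,\Gamma(k_3)$ (disjoint union) with $k_1+k_2+k_3=0$; equivalently, a partition of $\{\Gamma(k): k\in\mathbb{Z}_{2^n-1}\setminus g\mathbb{Z}_{2^n-1}\}$ into $3$-element subsets $\{\Gamma(k_1),\Gamma(k_2),\Gamma(k_3)\}$ with $k_1+k_2+k_3=0$.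
   Context: For a vector space $V$ over $\mathbb{F}_q$, a triangle is a set $\{\langle a,b\rangle,\langle b,c\rangle,\langle c,a\rangle\}$ of three $2$-dimensional subspaces with $a,b,c$ linearly independent. For $m\mid n$, a group divisible triangle design of order $n$ with groups of dimension $m$ over $\mathbb{F}_q$ is a triple $(V,\mathcal{G},\mathcal{B})$: $V$ an $n$-dimensional $\mathbb{F}_q$-space, $\mathcal{G}$ a set of $m$-dimensional subspaces such that every nonzero vector lies in exactly one, and $\mathcal{B}$ a set of triangles such that every $2$-dimensional subspace either belongs to exactly one triangle of $\mathcal{B}$ and to no group, or to no triangle and to one group. A triangle covers a nonzero vector $x$ if $x$ lies in one of its three subspaces; the design is balanced if all nonzero vectors are covered by the same number of triangles of $\mathcal{B}$. Invariance under $\mathbb{F}_{2^n}^*$ means that for each $\gamma\in\mathbb{F}_{2^n}^*$ the map $y\mapsto\gamma y$ maps $\mathcal{B}$ onto itself. Elements of $\mathbb{Z}_{2^n-1}$ are exponents of $\xi$ (arithmetic mod $2^n-1$). For nonzero $k\in\mathbb{Z}_{2^n-1}$, the Zech logarithm $\mathrm{Z}(k)$ is defined by $1+\xi^k=\xi^{\mathrm{Z}(k)}$, and $\Gamma(k)=\{k,\mathrm{Z}(k),\mathrm{Z}(-k),-\mathrm{Z}(-k),-\mathrm{Z}(k),-k\}$.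
   Formalization: The second form of (ii) is stated with the added condition that every Γ(k) has 6 elements; without it the "equivalently" fails, e.g. n=4, m=1, where Γ(5)={5,10} and {Γ(3),Γ(7),Γ(5)} is a 3-subset partition but 18 does not divide 14. *)

theory Defs
  imports Complex_Main "HOL-Library.Z2" "HOL-Library.Disjoint_Sets"
begin

definition triangle ::
  "('k::field \<Rightarrow> 'v::ab_group_add \<Rightarrow> 'v) \<Rightarrow> 'v set \<Rightarrow> 'v set set \<Rightarrow> bool" where
  "triangle scale V T \<longleftrightarrow>
     (\<exists>a\<in>V. \<exists>b\<in>V. \<exists>c\<in>V.
        distinct [a, b, c] \<and> \<not> module.dependent scale {a, b, c} \<and>
        T = {module.span scale {a, b}, module.span scale {b, c}, module.span scale {c, a}})"

text \<open>
  The ground field \<open>'k\<close> is meant to be finite, so an \<open>n\<close>-dimensional space \<open>V\<close> is a finite set.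
  A subspace belongs to a triangle if it is an element of it, and to a group if it is
  contained in it.
\<close>

definition gd_triangle_design ::
  "('k::field \<Rightarrow> 'v::ab_group_add \<Rightarrow> 'v) \<Rightarrow> nat \<Rightarrow> nat \<Rightarrow>
     'v set \<Rightarrow> 'v set set \<Rightarrow> 'v set set set \<Rightarrow> bool" where
  "gd_triangle_design scale n m V G B \<longleftrightarrow>
     vector_space scale \<and> m dvd n \<and>
     finite V \<and> module.subspace scale V \<and> vector_space.dim scale V = n \<and>
     (\<forall>U\<in>G. U \<subseteq> V \<and> module.subspace scale U \<and> vector_space.dim scale U = m) \<and>
     (\<forall>x\<in>V - {0}. \<exists>!U. U \<in> G \<and> x \<in> U) \<and>
     (\<forall>T\<in>B. triangle scale V T) \<and>
     (\<forall>L. L \<subseteq> V \<and> module.subspace scale L \<and> vector_space.dim scale L = 2 \<longrightarrow>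
        (\<exists>!T. T \<in> B \<and> L \<in> T) \<and> \<not> (\<exists>U\<in>G. L \<subseteq> U) \<or>
        \<not> (\<exists>T\<in>B. L \<in> T) \<and> (\<exists>!U. U \<in> G \<and> L \<subseteq> U))"

definition covers :: "'v set set \<Rightarrow> 'v \<Rightarrow> bool" where
  "covers T x \<longleftrightarrow> (\<exists>L\<in>T. x \<in> L)"

definition balanced :: "'v::zero set \<Rightarrow> 'v set set set \<Rightarrow> bool" where
  "balanced V B \<longleftrightarrow> (\<exists>r. \<forall>x\<in>V - {0}. card {T \<in> B. covers T x} = r)"

definition mult_invariant :: "'a::field set set set \<Rightarrow> bool" where
  "mult_invariant B \<longleftrightarrow> (\<forall>\<gamma>. \<gamma> \<noteq> 0 \<longrightarrow> (\<lambda>T. (\<lambda>L. (\<lambda>y. \<gamma> * y) ` L) ` T) ` B = B)"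

text \<open>The action of the two-element field on a ring; it is a vector space in characteristic 2.\<close>

definition f2_scale :: "bit \<Rightarrow> 'a::ring_1 \<Rightarrow> 'a" where
  "f2_scale b x = of_bit b * x"

definition is_subfield :: "'a::field set \<Rightarrow> bool" where
  "is_subfield K \<longleftrightarrow> 0 \<in> K \<and> 1 \<in> K \<and>
     (\<forall>x\<in>K. \<forall>y\<in>K. x + y \<in> K \<and> x * y \<in> K) \<and> (\<forall>x\<in>K. - x \<in> K \<and> inverse x \<in> K)"

text \<open>A finite field has at most one subfield of each order, and exactly one of order
  \<open>2 ^ m\<close> if its own order is \<open>2 ^ n\<close> with \<open>m dvd n\<close>.\<close>

definition subfield_of_order :: "nat \<Rightarrow> 'a::field set" where
  "subfield_of_order q = (THE K. is_subfield K \<and> card K = q)"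

definition desarguesian_spread :: "nat \<Rightarrow> 'a::field set set" where
  "desarguesian_spread m = {(\<lambda>y. a * y) ` subfield_of_order (2 ^ m) | a. a \<noteq> 0}"

definition primitive_element :: "'a::field \<Rightarrow> bool" where
  "primitive_element \<xi> \<longleftrightarrow> range (\<lambda>i::nat. \<xi> ^ i) = UNIV - {0}"

text \<open>Residue classes modulo \<open>2 ^ n - 1\<close> are represented by their least nonnegative
  representatives.\<close>

definition exponents :: "nat \<Rightarrow> int set" where
  "exponents n = {0..<2 ^ n - 1}"

definition multiples :: "nat \<Rightarrow> int \<Rightarrow> int set" where
  "multiples n g = (\<lambda>j. (g * j) mod (2 ^ n - 1)) ` exponents n"

definition zech :: "nat \<Rightarrow> 'a::field \<Rightarrow> int \<Rightarrow> int" where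
  "zech n \<xi> k = (THE j. j \<in> exponents n \<and> 1 + \<xi> powi k = \<xi> powi j)"

text \<open>Only meant for \<open>k\<close> not divisible by \<open>2 ^ n - 1\<close>. The six exponents are distinct except when
  \<open>\<xi> powi k\<close> is a primitive cube root of unity: then the set is \<open>{k, - k}\<close> modulo
  \<open>2 ^ n - 1\<close>.\<close>

definition Gam :: "nat \<Rightarrow> 'a::field \<Rightarrow> int \<Rightarrow> int set" where
  "Gam n \<xi> k = (\<lambda>j. j mod (2 ^ n - 1)) `
     {k, zech n \<xi> k, zech n \<xi> (- k), - zech n \<xi> (- k), - zech n \<xi> k, - k}"

end

theory Submission
  imports Defs
begin

text \<open>
  Two lines of the field over the two-element field are homothetic iff their sets of ratios of distinct
  nonzero points meet, and then these sets coincide; \<open>\<Gamma>(k)\<close> is the set of logarithms of the ratios of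
  a line through \<open>1\<close> and \<open>\<xi>\<^sup>k\<close>. Three ratios of the sides of a triangle, taken cyclically, multiply
  to \<open>1\<close>, which is the condition \<open>k\<^sub>1 + k\<^sub>2 + k\<^sub>3 = 0\<close>. No homothety other than the identity fixes a triangle, so in an
  invariant design the three sides of a triangle lie in different orbits of lines with trivial
  stabilizers, and the orbits of triangles correspond to the \<open>18\<close>-element blocks.
\<close>

section \<open>Finite subfields\<close>

text \<open>The groups are the cosets of the subfield of order \<open>2 ^ m\<close>, whose nonzero
  elements are the powers of \<open>\<xi>\<close> with exponent divisible by \<open>g\<close>. Hence
  the exponents outside the multiples of \<open>g\<close> label exactly the lines that no group
  contains. Two degenerate cases shape the proof. A coset of the subfield of order four, when there
  is one, is a line with a nontrivial stabilizer and only two ratios. In a block it is excluded by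
  the count 18 = 3 * 6; a triple of distinct \<Gamma>-sets does not exclude it, so that form of the
  condition also demands six elements. Secondly, three exponents with sum 0 might come from three
  points on one line. Such points would give equal \<Gamma>-sets, which the disjointness within a
  block forbids. A block does not determine its orbit of triangles: interchanging two of the
  exponents gives another triangle with the same \<Gamma>-sets. The construction of a design
  therefore chooses one triangle per block.\<close>

lemma is_subfield_UNIV: "is_subfield UNIV"
  by (simp add: is_subfield_def)

text \<open>Multiplication by \<open>x\<close> permutes the nonzero elements of \<open>K\<close>, so
  their product equals itself times the power of \<open>x\<close>; cancel.\<close>

lemma subfield_power_card:
  fixes K :: "'a::{field,finite} set"
  assumes K: "is_subfield K" and x: "x \<in> K" "x \<noteq> 0"
  shows "x ^ (card K - 1) = 1"
proof -
  let ?U = "K - {0}"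
  have *: "u \<in> (\<lambda>y. x * y) ` ?U" if "u \<in> ?U" for u
  proof (rule image_eqI)
    show "u = x * (inverse x * u)" using x by simp
    show "inverse x * u \<in> ?U" using K x that by (auto simp: is_subfield_def)
  qed
  have "(\<lambda>y. x * y) ` ?U = ?U"
    using K x * by (auto simp: is_subfield_def)
  moreover have "inj_on (\<lambda>y. x * y) ?U"
    using x by (simp add: inj_on_def)
  ultimately have "(\<Prod>y\<in>?U. y) = (\<Prod>y\<in>?U. x * y)"
    using prod.reindex[of "\<lambda>y. x * y" ?U "\<lambda>y. y"] by simp
  also have "\<dots> = x ^ card ?U * (\<Prod>y\<in>?U. y)"
    by (simp add: prod.distrib)
  finally have "x ^ card ?U = 1" by simp
  moreover have "0 \<in> K" using K by (simp add: is_subfield_def)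
  ultimately show ?thesis by simp
qed

text \<open>If \<open>x = a * k\<close> with \<open>k\<close> nonzero in \<open>K\<close>, then
  \<open>k\<close> is a unit of \<open>K\<close> and is absorbed. Every nonzero point may thus
  represent its coset.\<close>

lemma subfield_coset_eq:
  assumes K: "is_subfield K" and x: "x \<in> (\<lambda>y. a * y) ` K" "x \<noteq> 0"
  shows "(\<lambda>y. a * y) ` K = (\<lambda>y. x * y) ` K"
proof -
  obtain k where k: "k \<in> K" "x = a * k" using x by auto
  with x have 0: "k \<noteq> 0" by auto
  show ?thesis
  proof (intro equalityI subsetI)
    fix z assume "z \<in> (\<lambda>y. a * y) ` K"
    then obtain l where l: "l \<in> K" "z = a * l" by auto
    have "z = x * (inverse k * l)" using l k 0 by (simp add: field_simps)
    moreover have "inverse k * l \<in> K" using K k l by (simp add: is_subfield_def)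
    ultimately show "z \<in> (\<lambda>y. x * y) ` K" by blast
  next
    fix z assume "z \<in> (\<lambda>y. x * y) ` K"
    then show "z \<in> (\<lambda>y. a * y) ` K" using K k by (auto simp: is_subfield_def mult.assoc)
  qed
qed

section \<open>Logarithms to a primitive base\<close>

locale binary_field =
  fixes \<xi> :: "'a::{field,finite}" and n :: nat
  assumes card_field: "card (UNIV :: 'a set) = 2 ^ n"
    and primitive: "primitive_element \<xi>"
begin

text \<open>The two-dimensional subspaces, written out as sets of four vectors so that ratios and
  images can be computed directly; \<open>f2_line_iff\<close> supplies the identification.\<close>

definition lines :: "'a set set" where
  "lines = {{0, u, v, u + v} | u v. u \<noteq> 0 \<and> v \<noteq> 0 \<and> u \<noteq> v}"

lemma n_pos: "0 < n"
proof (rule ccontr)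
  assume "\<not> 0 < n"
  then have "card (UNIV :: 'a set) = 1" using card_field by simp
  then obtain a :: 'a where "UNIV = {a}" by (auto simp: card_1_singleton_iff)
  then have "(0 :: 'a) = a" "(1 :: 'a) = a" by auto
  then show False by simp
qed

lemma power_eq_1: "x \<noteq> 0 \<Longrightarrow> x ^ (2 ^ n - 1) = (1 :: 'a)"
  using subfield_power_card[OF is_subfield_UNIV, of x] by (simp add: card_field)

text \<open>Characteristic two comes from the order of the field alone: the exponent
  \<open>2 ^ n - 1\<close> is odd, so -1 raised to it is -1, but it is also 1.\<close>

lemma add_self [simp]: "x + x = (0 :: 'a)"
proof -
  have "(-1 :: 'a) ^ (2 ^ n - 1) = 1" by (rule power_eq_1) simp
  moreover have "odd (2 ^ n - 1 :: nat)" using n_pos by simp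
  ultimately have "(-1 :: 'a) = 1" by simp
  then have "1 + 1 = (0 :: 'a)" by (metis add.right_inverse)
  then have "x * (1 + 1) = 0" by simp
  then show ?thesis by (simp only: distrib_left mult_1_right)
qed

lemma uminus_eq [simp]: "- x = (x :: 'a)"
  using add_self by (simp add: minus_unique)

lemma minus_eq [simp]: "x - y = x + (y :: 'a)"
  by (metis diff_conv_add_uminus uminus_eq)

lemma add_self_left [simp]: "x + (x + y) = (y :: 'a)"
  by (simp flip: add.assoc)

lemma add_eq_0_iff_eq [simp]: "x + y = 0 \<longleftrightarrow> x = (y :: 'a)"
  by (metis add_self add_self_left add_0_right)

lemma add_eq_iff: "x + y = z \<longleftrightarrow> y = x + (z :: 'a)"
  by auto

lemma xi_nonzero [simp]: "\<xi> \<noteq> 0"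
proof -
  have "\<xi> ^ 1 \<in> UNIV - {0}" using primitive unfolding primitive_element_def by blast
  then show ?thesis by simp
qed

lemma exponents_eq: "exponents n = int ` {..<2 ^ n - 1}"
proof -
  have "int (2 ^ n - 1) = 2 ^ n - 1" by (simp add: of_nat_diff)
  then show ?thesis by (simp only: exponents_def lessThan_atLeast0 image_int_atLeastLessThan of_nat_0)
qed

text \<open>Primitivity yields only surjectivity, from all natural exponents. Reduction modulo
  \<open>2 ^ n - 1\<close> keeps it on the representatives, and as these are as many as the nonzero
  elements, injectivity follows by counting.\<close>

lemma powi_bij: "bij_betw (\<lambda>k. \<xi> powi k) (exponents n) (UNIV - {0})"
proof -
  let ?N = "2 ^ n - 1 :: nat"
  have N: "?N > 0" using one_less_power[of "2 :: nat", OF _ n_pos] by simp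
  have red: "\<xi> ^ i = \<xi> ^ (i mod ?N)" for i
  proof -
    have "\<xi> ^ i = \<xi> ^ (?N * (i div ?N) + i mod ?N)" by simp
    also have "\<dots> = (\<xi> ^ ?N) ^ (i div ?N) * \<xi> ^ (i mod ?N)" by (simp only: power_add power_mult)
    finally show ?thesis by (simp only: power_eq_1[OF xi_nonzero] power_one mult_1)
  qed
  have "UNIV - {0} = range (\<lambda>i::nat. \<xi> ^ i)" using primitive by (simp add: primitive_element_def)
  also have "\<dots> = (\<lambda>i. \<xi> ^ i) ` {..<?N}"
  proof (intro equalityI subsetI)
    fix x assume "x \<in> range (\<lambda>i::nat. \<xi> ^ i)"
    then obtain i where "x = \<xi> ^ i" by auto
    then have "x = \<xi> ^ (i mod ?N)" using red by simp
    moreover have "i mod ?N \<in> {..<?N}" using N by simp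
    ultimately show "x \<in> (\<lambda>i. \<xi> ^ i) ` {..<?N}" by blast
  qed auto
  finally have im: "(\<lambda>i. \<xi> ^ i) ` {..<?N} = UNIV - {0}" by simp
  have "card (UNIV - {0 :: 'a}) = ?N" using card_field by (simp add: card_Diff_singleton)
  then have "inj_on (\<lambda>i. \<xi> ^ i) {..<?N}"
    by (intro eq_card_imp_inj_on) (simp_all only: im finite_lessThan card_lessThan)
  with im have "bij_betw (\<lambda>i. \<xi> ^ i) {..<?N} (UNIV - {0})" by (simp add: bij_betw_def)
  then show ?thesis
    unfolding exponents_eq bij_betw_def
    by (auto simp: inj_on_def image_image)
qed

lemma powi_mod: "\<xi> powi (k mod (2 ^ n - 1)) = \<xi> powi k"
proof -
  let ?N = "2 ^ n - 1 :: int"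
  have "\<xi> powi (2 ^ n - 1) = \<xi> powi int (2 ^ n - 1)" by (simp add: of_nat_diff)
  also have "\<dots> = 1" using power_eq_1[OF xi_nonzero] by (simp only: power_int_of_nat)
  finally have 1: "\<xi> powi ?N = 1" .
  have "\<xi> powi k = \<xi> powi (?N * (k div ?N) + k mod ?N)" by simp
  also have "\<dots> = (\<xi> powi ?N) powi (k div ?N) * \<xi> powi (k mod ?N)"
    by (subst power_int_add) (simp_all add: power_int_mult)
  finally show ?thesis by (simp add: 1)
qed

lemma mod_in_exponents [simp]: "k mod (2 ^ n - 1) \<in> exponents n"
proof -
  have "(2 :: int) ^ n > 1" using n_pos by simp
  then show ?thesis by (simp add: exponents_def)
qed

lemma mod_exponents: "k \<in> exponents n \<Longrightarrow> k mod (2 ^ n - 1) = k"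
  by (simp add: exponents_def)

lemma powi_eq_iff: "\<xi> powi k = \<xi> powi j \<longleftrightarrow> k mod (2 ^ n - 1) = j mod (2 ^ n - 1)"
proof
  assume "\<xi> powi k = \<xi> powi j"
  then have "\<xi> powi (k mod (2 ^ n - 1)) = \<xi> powi (j mod (2 ^ n - 1))" by (simp only: powi_mod)
  then show "k mod (2 ^ n - 1) = j mod (2 ^ n - 1)"
    by (rule inj_onD[OF bij_betw_imp_inj_on[OF powi_bij]]) simp_all
next
  assume "k mod (2 ^ n - 1) = j mod (2 ^ n - 1)"
  then show "\<xi> powi k = \<xi> powi j" by (metis powi_mod)
qed

lemma powi_eq_1_iff: "\<xi> powi k = 1 \<longleftrightarrow> k mod (2 ^ n - 1) = 0"
  using powi_eq_iff[of k 0] by simp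

lemma ex_log: "x \<noteq> 0 \<Longrightarrow> \<exists>k\<in>exponents n. \<xi> powi k = x"
  using bij_betw_imp_surj_on[OF powi_bij] by (metis DiffI UNIV_I imageE singletonD)

text \<open>The assumption excludes 1 + 1 = 0, the one sum without a logarithm.\<close>

lemma zech:
  assumes "\<xi> powi k \<noteq> 1"
  shows "\<xi> powi zech n \<xi> k = 1 + \<xi> powi k"
proof -
  have "1 + \<xi> powi k \<noteq> 0" using assms by auto
  then obtain j where j: "j \<in> exponents n" "1 + \<xi> powi k = \<xi> powi j" using ex_log by metis
  have "zech n \<xi> k = j"
    unfolding zech_def
  proof (rule the_equality)
    fix i assume i: "i \<in> exponents n \<and> 1 + \<xi> powi k = \<xi> powi i"
    with j have "\<xi> powi i = \<xi> powi j" by simp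
    then show "i = j" using i j by (simp add: powi_eq_iff mod_exponents)
  qed (use j in simp)
  then show ?thesis using j by simp
qed

text \<open>Only the canonical representatives are taken, so that equality of residue sets is plain
  equality. The element 0 is dropped, having no logarithm.\<close>

definition log_set :: "'a set \<Rightarrow> int set" where
  "log_set A = {j \<in> exponents n. \<xi> powi j \<in> A}"

lemma card_log_set: "0 \<notin> A \<Longrightarrow> card (log_set A) = card A"
proof (rule bij_betw_same_card)
  assume "0 \<notin> A"
  show "bij_betw (\<lambda>k. \<xi> powi k) (log_set A) A"
  proof (rule bij_betw_subset[OF powi_bij])
    show "(\<lambda>k. \<xi> powi k) ` log_set A = A"
    proof (intro equalityI subsetI)
      fix x assume "x \<in> A"
      then have "x \<noteq> 0" using \<open>0 \<notin> A\<close> by auto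
      then obtain k where "k \<in> exponents n" "\<xi> powi k = x" using ex_log by blast
      with \<open>x \<in> A\<close> show "x \<in> (\<lambda>k. \<xi> powi k) ` log_set A" by (auto simp: log_set_def)
    qed (auto simp: log_set_def)
  qed (auto simp: log_set_def)
qed

section \<open>Lines over the two-element field\<close>

definition ratios :: "'a set \<Rightarrow> 'a set" where
  "ratios L = {u / v | u v. u \<in> L \<and> v \<in> L \<and> u \<noteq> 0 \<and> v \<noteq> 0 \<and> u \<noteq> v}"

lemma ratios_nonzero: "0 \<notin> ratios L"
  by (auto simp: ratios_def)

lemma ratios_eq_image:
  assumes "a \<noteq> 0" "b \<noteq> 0" "a \<noteq> b"
  shows "ratios {0, a, b, a + b} =
    (\<lambda>(u, v). u / v) ` {(a, b), (b, a), (a, a + b), (a + b, a), (b, a + b), (a + b, b)}"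
proof -
  have "{(a, b), (b, a), (a, a + b), (a + b, a), (b, a + b), (a + b, b)} =
      {(u, v). u \<in> {0, a, b, a + b} \<and> v \<in> {0, a, b, a + b} \<and> u \<noteq> 0 \<and> v \<noteq> 0 \<and> u \<noteq> v}"
    using assms by auto
  then show ?thesis unfolding ratios_def by auto
qed

lemma ratios_line:
  assumes "a \<noteq> 0" "b \<noteq> 0" "a \<noteq> b"
  shows "ratios {0, a, b, a + b} = {a / b, (a + b) / b, (a + b) / a, a / (a + b), b / (a + b), b / a}"
  unfolding ratios_eq_image[OF assms] by auto

text \<open>With \<open>a / b = \<xi> powi k\<close>, the Zech logarithms of \<open>k\<close> and
  \<open>- k\<close> are the logarithms of \<open>(a + b) / b\<close> and
  \<open>(a + b) / a\<close>; negating an exponent inverts the ratio.\<close>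

lemma Gam_eq:
  assumes "\<xi> powi k \<noteq> 1" "a / b = \<xi> powi k" "b \<noteq> 0"
  shows "Gam n \<xi> k = log_set (ratios {0, a, b, a + b})"
proof -
  let ?x = "\<xi> powi k"
  have a: "a \<noteq> 0" using assms by auto
  have ab: "a \<noteq> b" using assms by auto
  have ab0: "a + b \<noteq> 0" using ab by simp
  have inv: "\<xi> powi (- k) = b / a" using assms(2) by (simp add: power_int_minus flip: assms(2))
  have inv1: "\<xi> powi (- k) \<noteq> 1" unfolding inv using a ab by simp
  have z: "\<xi> powi zech n \<xi> k = (a + b) / b"
    using assms(3) by (simp add: zech[OF assms(1)] add_divide_distrib add.commute flip: assms(2))
  have z': "\<xi> powi zech n \<xi> (- k) = (a + b) / a"
    using a by (simp add: zech[OF inv1] inv add_divide_distrib)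
  have mz: "\<xi> powi (- zech n \<xi> k) = b / (a + b)" using z by (simp add: power_int_minus)
  have mz': "\<xi> powi (- zech n \<xi> (- k)) = a / (a + b)" using z' by (simp add: power_int_minus)
  let ?J = "{k, zech n \<xi> k, zech n \<xi> (- k), - zech n \<xi> (- k), - zech n \<xi> k, - k}"
  have im: "ratios {0, a, b, a + b} = (\<lambda>j. \<xi> powi j) ` ?J"
    unfolding ratios_line[OF a assms(3) ab] image_insert image_empty z z' mz mz' inv
    using assms by simp
  have "j \<in> Gam n \<xi> k \<longleftrightarrow> j \<in> log_set (ratios {0, a, b, a + b})" for j
  proof
    assume "j \<in> Gam n \<xi> k"
    then obtain i where "i \<in> ?J" "j = i mod (2 ^ n - 1)" unfolding Gam_def by blast
    then show "j \<in> log_set (ratios {0, a, b, a + b})"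
      unfolding log_set_def im using powi_mod[of i] by (auto simp del: insert_iff)
  next
    assume "j \<in> log_set (ratios {0, a, b, a + b})"
    then obtain i where i: "i \<in> ?J" "\<xi> powi j = \<xi> powi i" and j: "j \<in> exponents n"
      unfolding log_set_def im by blast
    then have "j = i mod (2 ^ n - 1)" using powi_eq_iff mod_exponents by metis
    with i(1) show "j \<in> Gam n \<xi> k" unfolding Gam_def by blast
  qed
  then show ?thesis by blast
qed

lemma lineI: "a \<noteq> 0 \<Longrightarrow> b \<noteq> 0 \<Longrightarrow> a \<noteq> b \<Longrightarrow> {0, a, b, a + b} \<in> lines"
  unfolding lines_def by blast

lemma line_nonzero: "L \<in> lines \<Longrightarrow> \<exists>u\<in>L. u \<noteq> 0"
  unfolding lines_def by auto

lemma line_eq: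
  assumes "L \<in> lines" "u \<in> L" "v \<in> L" "u \<noteq> 0" "v \<noteq> 0" "u \<noteq> v"
  shows "L = {0, u, v, u + v}"
  using assms unfolding lines_def by (auto simp: ac_simps)

lemma ratios_scale:
  assumes "\<gamma> \<noteq> 0"
  shows "ratios ((\<lambda>y. \<gamma> * y) ` L) = ratios L"
proof -
  have "u / v = (\<gamma> * u) / (\<gamma> * v)" for u v using assms by simp
  then have "u / v \<in> ratios ((\<lambda>y. \<gamma> * y) ` L)" if "u \<in> L" "v \<in> L" "u \<noteq> 0" "v \<noteq> 0" "u \<noteq> v" for u v
    using that assms unfolding ratios_def
    by (intro CollectI exI[of _ "\<gamma> * u"] exI[of _ "\<gamma> * v"]) simp
  then have "ratios L \<subseteq> ratios ((\<lambda>y. \<gamma> * y) ` L)" unfolding ratios_def[of L] by blast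
  moreover have "ratios ((\<lambda>y. \<gamma> * y) ` L) \<subseteq> ratios L"
  proof
    fix x assume "x \<in> ratios ((\<lambda>y. \<gamma> * y) ` L)"
    then obtain u v where "u \<in> L" "v \<in> L" "u \<noteq> 0" "v \<noteq> 0" "u \<noteq> v" "x = (\<gamma> * u) / (\<gamma> * v)"
      unfolding ratios_def using assms by auto
    moreover from this have "x = u / v" using assms by simp
    ultimately show "x \<in> ratios L" unfolding ratios_def by blast
  qed
  ultimately show ?thesis by blast
qed

lemma ratios_meet:
  assumes L: "L \<in> lines" "L' \<in> lines" and x: "x \<in> ratios L" "x \<in> ratios L'"
  obtains \<gamma> where "\<gamma> \<noteq> 0" "L' = (\<lambda>y. \<gamma> * y) ` L"
proof -
  obtain u v where uv: "u \<in> L" "v \<in> L" "u \<noteq> 0" "v \<noteq> 0" "u \<noteq> v" "x = u / v"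
    using x by (auto simp: ratios_def)
  obtain u' v' where uv': "u' \<in> L'" "v' \<in> L'" "u' \<noteq> 0" "v' \<noteq> 0" "u' \<noteq> v'" "x = u' / v'"
    using x by (auto simp: ratios_def)
  \<comment> \<open>This factor takes \<open>v\<close> to \<open>v'\<close>; equality of the two
    ratios makes it take \<open>u\<close> to \<open>u'\<close> as well, and two points determine a
    line.\<close>
  define \<gamma> where "\<gamma> = v' / v"
  have "v' = \<gamma> * v" "u' = \<gamma> * u" using uv uv' by (auto simp: \<gamma>_def field_simps)
  then have "L' = (\<lambda>y. \<gamma> * y) ` L"
    using line_eq[OF L(1) uv(1-5)] line_eq[OF L(2) uv'(1-5)] by (simp add: distrib_left)
  moreover have "\<gamma> \<noteq> 0" using uv uv' by (simp add: \<gamma>_def)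
  ultimately show thesis using that by blast
qed

lemma ratios_eqI:
  assumes "L \<in> lines" "L' \<in> lines" "x \<in> ratios L" "x \<in> ratios L'"
  shows "ratios L = ratios L'"
  using ratios_meet[OF assms] ratios_scale by metis

text \<open>Equal ratios of two pairs of points of \<open>L\<close> yield a homothety fixing \<open>L\<close>, and vice versa.\<close>

lemma card_ratios_eq_6_iff:
  assumes L: "L \<in> lines"
  shows "card (ratios L) = 6 \<longleftrightarrow> (\<forall>\<gamma>. (\<lambda>y. \<gamma> * y) ` L = L \<longrightarrow> \<gamma> = 1)"
proof -
  obtain a b where ab: "a \<noteq> 0" "b \<noteq> 0" "a \<noteq> b" "L = {0, a, b, a + b}"
    using L unfolding lines_def by auto
  let ?P = "{(a, b), (b, a), (a, a + b), (a + b, a), (b, a + b), (a + b, b)}"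
  have P: "?P = {(u, v). u \<in> L \<and> v \<in> L \<and> u \<noteq> 0 \<and> v \<noteq> 0 \<and> u \<noteq> v}"
    using ab by auto
  have cP: "card ?P = 6" using ab by (simp add: card_insert_if)
  have im: "ratios L = (\<lambda>(u, v). u / v) ` ?P" unfolding P ratios_def by auto
  have "card (ratios L) = 6 \<longleftrightarrow> inj_on (\<lambda>(u, v). u / v) ?P"
    unfolding im using cP card_image[of _ ?P] eq_card_imp_inj_on[of ?P] by (metis finite)
  also have "\<dots> \<longleftrightarrow> (\<forall>\<gamma>. (\<lambda>y. \<gamma> * y) ` L = L \<longrightarrow> \<gamma> = 1)"
  proof (intro iffI allI impI)
    fix \<gamma> assume inj: "inj_on (\<lambda>(u, v). u / v) ?P" and \<gamma>: "(\<lambda>y. \<gamma> * y) ` L = L"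
    have "\<gamma> \<noteq> 0" using \<gamma> ab by auto
    moreover have "\<gamma> * a \<in> L" "\<gamma> * b \<in> L" using \<gamma> ab(4) by blast+
    ultimately have "(\<gamma> * a, \<gamma> * b) \<in> ?P" "(a, b) \<in> ?P" unfolding P using ab by auto
    moreover have "(\<gamma> * a) / (\<gamma> * b) = a / b" using \<open>\<gamma> \<noteq> 0\<close> by simp
    ultimately have "(\<gamma> * a, \<gamma> * b) = (a, b)" using inj_onD[OF inj] by (metis case_prod_conv)
    then show "\<gamma> = 1" using ab by simp
  next
    assume st: "\<forall>\<gamma>. (\<lambda>y. \<gamma> * y) ` L = L \<longrightarrow> \<gamma> = 1"
    show "inj_on (\<lambda>(u, v). u / v) ?P" unfolding P
    proof (rule inj_onI, clarify)
      fix u v u' v' assume uv: "u \<in> L" "v \<in> L" "u \<noteq> 0" "v \<noteq> 0" "u \<noteq> v"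
        and uv': "u' \<in> L" "v' \<in> L" "u' \<noteq> 0" "v' \<noteq> 0" "u' \<noteq> v'" and eq: "u / v = u' / v'"
      define \<gamma> where "\<gamma> = v' / v"
      have v': "v' = \<gamma> * v" "u' = \<gamma> * u" using uv uv' eq by (auto simp: \<gamma>_def field_simps)
      then have "(\<lambda>y. \<gamma> * y) ` L = L"
        using line_eq[OF L uv] line_eq[OF L uv']
        by (metis (no_types, lifting) distrib_left image_empty image_insert mult_zero_right)
      with st have "\<gamma> = 1" by blast
      with v' show "u = u' \<and> v = v'" by simp
    qed
  qed
  finally show ?thesis .
qed

text \<open>A line has six ordered pairs of distinct nonzero points. The bound is strict for the
  cosets of a subfield of order four.\<close>

lemma card_ratios_le:
  assumes "L \<in> lines"
  shows "card (ratios L) \<le> 6"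
proof -
  obtain a b where ab: "a \<noteq> 0" "b \<noteq> 0" "a \<noteq> b" "L = {0, a, b, a + b}"
    using assms unfolding lines_def by auto
  let ?P = "[(a, b), (b, a), (a, a + b), (a + b, a), (b, a + b), (a + b, b)]"
  have "ratios L = set (map (\<lambda>(u, v). u / v) ?P)"
    unfolding ab(4) ratios_eq_image[OF ab(1-3)] by simp
  also have "card \<dots> \<le> length (map (\<lambda>(u, v). u / v) ?P)" by (rule card_length)
  finally show ?thesis by simp
qed

section \<open>Subspaces and triangles\<close>

text \<open>Characteristic two enters where both scalars are 1: there \<open>a + b\<close> is 0, and
  distributivity says \<open>x + x = 0\<close>.\<close>

sublocale f2: vector_space "f2_scale :: bit \<Rightarrow> 'a \<Rightarrow> 'a"
proof
  fix a b :: bit and x y :: 'a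
  show "f2_scale a (x + y) = f2_scale a x + f2_scale a y"
    by (simp add: f2_scale_def)
  show "f2_scale (a + b) x = f2_scale a x + f2_scale b x"
    by (cases a; cases b) (simp_all add: f2_scale_def)
  show "f2_scale a (f2_scale b x) = f2_scale (a * b) x"
    by (cases a; cases b) (simp_all add: f2_scale_def)
  show "f2_scale 1 x = x"
    by (simp add: f2_scale_def)
qed

lemma f2_subspace_iff: "f2.subspace U \<longleftrightarrow> 0 \<in> U \<and> (\<forall>x\<in>U. \<forall>y\<in>U. x + y \<in> U)"
  by (auto simp: f2.subspace_def f2_scale_def)

text \<open>The coefficient of \<open>a\<close> can only be 0 or 1.\<close>

lemma f2_span_insert: "f2.span (insert a S) = f2.span S \<union> (\<lambda>y. a + y) ` f2.span S"
proof -
  have "x \<in> f2.span (insert a S) \<longleftrightarrow> x \<in> f2.span S \<or> a + x \<in> f2.span S" for x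
  proof
    assume "x \<in> f2.span (insert a S)"
    then obtain k where k: "x - f2_scale k a \<in> f2.span S" unfolding f2.span_breakdown_eq ..
    show "x \<in> f2.span S \<or> a + x \<in> f2.span S"
      using k by (cases k) (simp_all add: f2_scale_def add.commute)
  next
    assume "x \<in> f2.span S \<or> a + x \<in> f2.span S"
    then have "x - f2_scale 0 a \<in> f2.span S \<or> x - f2_scale 1 a \<in> f2.span S"
      by (simp add: add.commute)
    then show "x \<in> f2.span (insert a S)" unfolding f2.span_breakdown_eq by blast
  qed
  moreover have "a + x \<in> f2.span S \<longleftrightarrow> x \<in> (\<lambda>y. a + y) ` f2.span S" for x
    by (metis add_self_left imageE imageI)
  ultimately show ?thesis by blast
qed

lemma f2_span_pair: "f2.span {a, b} = {0, a, b, a + b}"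
  by (auto simp: f2_span_insert)

text \<open>Each new basis vector adds a disjoint translate of the span and doubles it. From here on
  dimensions are found by counting vectors.\<close>

lemma card_f2_span:
  assumes "f2.independent S"
  shows "card (f2.span S) = 2 ^ card S"
  using finite[of S] assms
proof (induction S rule: finite_induct)
  case (insert a S)
  then have a: "a \<notin> f2.span S" and S: "f2.independent S"
    using f2.independent_insert[of a S] by auto
  have "f2.span S \<inter> (\<lambda>y. a + y) ` f2.span S = {}"
  proof (rule ccontr)
    assume "f2.span S \<inter> (\<lambda>y. a + y) ` f2.span S \<noteq> {}"
    then obtain y where y: "y \<in> f2.span S" "a + y \<in> f2.span S" by auto
    have "a = (a + y) + y" by (simp add: add.assoc)
    with y have "a \<in> f2.span S" using f2.span_add by metis
    with a show False by simp
  qed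
  then have "card (f2.span (insert a S)) = card (f2.span S) + card ((\<lambda>y. a + y) ` f2.span S)"
    unfolding f2_span_insert by (intro card_Un_disjoint) auto
  also have "card ((\<lambda>y. a + y) ` f2.span S) = card (f2.span S)"
    by (intro card_image) (simp add: inj_on_def)
  finally show ?case using insert S by simp
qed simp

lemma card_f2_subspace:
  assumes "f2.subspace U"
  shows "card U = 2 ^ f2.dim U"
proof -
  obtain S where S: "S \<subseteq> U" "f2.independent S" "U \<subseteq> f2.span S" "card S = f2.dim U"
    using f2.basis_exists by blast
  have "f2.span S = U" using S assms f2.span_minimal[of S U] by blast
  with card_f2_span[OF S(2)] S(4) show ?thesis by simp
qed

lemma f2_dim_eqI: "f2.subspace U \<Longrightarrow> card U = 2 ^ d \<Longrightarrow> f2.dim U = d"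
  using card_f2_subspace[of U] by simp

lemma f2_line_iff: "f2.subspace L \<and> f2.dim L = 2 \<longleftrightarrow> L \<in> lines"
proof
  assume L: "f2.subspace L \<and> f2.dim L = 2"
  then have card: "card L = 4" using card_f2_subspace[of L] by simp
  have 0: "0 \<in> L" using L f2.subspace_0 by blast
  \<comment> \<open>Four vectors leave room for a nonzero \<open>u\<close> and a further
    \<open>v\<close>; together with 0 and \<open>u + v\<close> they exhaust
    \<open>L\<close>.\<close>
  have "\<not> L \<subseteq> {0}" using card card_mono[of "{0}" L] by auto
  then obtain u where u: "u \<in> L" "u \<noteq> 0" by auto
  have "\<not> L \<subseteq> {0, u}" using card u card_mono[of "{0, u}" L] by auto
  then obtain v where v: "v \<in> L" "v \<noteq> 0" "u \<noteq> v" by auto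
  have "{0, u, v, u + v} = L"
  proof (rule card_subset_eq)
    show "{0, u, v, u + v} \<subseteq> L" using L u v 0 by (auto simp: f2_subspace_iff)
    have "card {0, u, v, u + v} = 4" using u v by (auto simp: card_insert_if)
    then show "card {0, u, v, u + v} = card L" using card by simp
  qed simp
  with u v show "L \<in> lines" using lineI by metis
next
  assume "L \<in> lines"
  then obtain u v where uv: "u \<noteq> 0" "v \<noteq> 0" "u \<noteq> v" "L = {0, u, v, u + v}"
    unfolding lines_def by auto
  have "f2.subspace L" using f2.subspace_span[of "{u, v}"] by (simp only: uv(4) f2_span_pair)
  moreover have "card L = 2 ^ 2" using uv by (auto simp: card_insert_if)
  ultimately show "f2.subspace L \<and> f2.dim L = 2" using f2_dim_eqI by blast
qed

section \<open>Triangles and their corners\<close>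

definition triangle_on :: "'a \<Rightarrow> 'a \<Rightarrow> 'a \<Rightarrow> 'a set set" where
  "triangle_on a b c = {{0, a, b, a + b}, {0, b, c, b + c}, {0, c, a, c + a}}"

text \<open>Linear independence of three vectors over the two-element field: a nontrivial relation
  says that one vector vanishes, that two coincide, or that all three sum to 0.\<close>

definition corners :: "'a \<Rightarrow> 'a \<Rightarrow> 'a \<Rightarrow> bool" where
  "corners a b c \<longleftrightarrow> a \<noteq> 0 \<and> b \<noteq> 0 \<and> c \<noteq> 0 \<and> a \<noteq> b \<and> b \<noteq> c \<and> c \<noteq> a \<and> a + b + c \<noteq> 0"

lemma triangle_iff:
  "triangle f2_scale UNIV T \<longleftrightarrow> (\<exists>a b c. corners a b c \<and> T = triangle_on a b c)"
proof -
  have "distinct [a, b, c] \<and> \<not> f2.dependent {a, b, c} \<longleftrightarrow> corners a b c" for a b c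
  proof (cases "distinct [a, b, c]")
    case True
    then have "{a, b, c} - {a} = {b, c}" "{a, b, c} - {b} = {a, c}" "{a, b, c} - {c} = {a, b}"
      by auto
    then have "f2.dependent {a, b, c} \<longleftrightarrow>
        a \<in> {0, b, c, b + c} \<or> b \<in> {0, a, c, a + c} \<or> c \<in> {0, a, b, a + b}"
      unfolding f2.dependent_def by (simp only: bex_simps f2_span_pair) simp
    also have "\<dots> \<longleftrightarrow> a = 0 \<or> b = 0 \<or> c = 0 \<or> a + b + c = 0"
      using True by (auto simp: ac_simps add_eq_iff)
    finally show ?thesis using True by (auto simp: corners_def)
  qed (auto simp: corners_def)
  then show ?thesis
    unfolding triangle_def triangle_on_def f2_span_pair bex_UNIV by blast
qed

lemma triangle_on_lines: "corners a b c \<Longrightarrow> L \<in> triangle_on a b c \<Longrightarrow> L \<in> lines"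
  unfolding corners_def triangle_on_def using lineI by blast

lemma triangle_on_scale:
  "(\<lambda>L. (\<lambda>y. \<gamma> * y) ` L) ` triangle_on a b c = triangle_on (\<gamma> * a) (\<gamma> * b) (\<gamma> * c)"
  unfolding triangle_on_def by (simp only: image_insert image_empty distrib_left mult_zero_right)

lemma corners_scale:
  assumes "\<gamma> \<noteq> 0" "corners a b c"
  shows "corners (\<gamma> * a) (\<gamma> * b) (\<gamma> * c)"
proof -
  have "\<gamma> * a + \<gamma> * b + \<gamma> * c = \<gamma> * (a + b + c)" by (simp only: distrib_left)
  then show ?thesis using assms unfolding corners_def by (metis mult_cancel_left no_zero_divisors)
qed

lemma corners_distinct_lines:
  assumes "corners a b c"
  shows "{0, a, b, a + b} \<noteq> {0, b, c, b + c}" "{0, b, c, b + c} \<noteq> {0, c, a, c + a}"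
    "{0, a, b, a + b} \<noteq> {0, c, a, c + a}"
proof -
  have c: "c \<notin> {0, a, b, a + b}" and a: "a \<notin> {0, b, c, b + c}"
    using assms by (auto simp: corners_def ac_simps)
  show "{0, a, b, a + b} \<noteq> {0, b, c, b + c}" using c by (metis insertCI)
  show "{0, b, c, b + c} \<noteq> {0, c, a, c + a}" using a by (metis insertCI)
  show "{0, a, b, a + b} \<noteq> {0, c, a, c + a}" using c by (metis insertCI)
qed

text \<open>A triangle is stored as a set of lines without named corners. Recovering them as the
  nonzero points on two sides shows that a homothety fixing the triangle permutes the
  corners.\<close>

lemma corners_eq:
  assumes "corners a b c"
  shows "{a, b, c} = {x. x \<noteq> 0 \<and> (\<exists>L\<in>triangle_on a b c. \<exists>M\<in>triangle_on a b c. L \<noteq> M \<and> x \<in> L \<and> x \<in> M)}"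
proof -
  let ?L = "{0, a, b, a + b}" and ?M = "{0, b, c, b + c}" and ?N = "{0, c, a, c + a}"
  have "?L \<inter> ?M = {0, b}" "?M \<inter> ?N = {0, c}" "?L \<inter> ?N = {0, a}"
    using assms by (auto simp: corners_def ac_simps)
  then have "{a, b, c} = (?L \<inter> ?M \<union> ?M \<inter> ?N \<union> ?L \<inter> ?N) - {0}"
    using assms by (simp only: corners_def) blast
  also have "\<dots> = {x. x \<noteq> 0 \<and> (\<exists>L\<in>{?L, ?M, ?N}. \<exists>M\<in>{?L, ?M, ?N}. L \<noteq> M \<and> x \<in> L \<and> x \<in> M)}"
  proof -
    have "(L \<inter> M \<union> M \<inter> N \<union> L \<inter> N) - {0} =
        {x. x \<noteq> 0 \<and> (\<exists>A\<in>{L, M, N}. \<exists>B\<in>{L, M, N}. A \<noteq> B \<and> x \<in> A \<and> x \<in> B)}"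
      if "L \<noteq> M" "M \<noteq> N" "L \<noteq> N" for L M N :: "'a set"
      using that by auto
    from this[OF corners_distinct_lines[OF assms]] show ?thesis .
  qed
  finally show ?thesis unfolding triangle_on_def .
qed

text \<open>A homothety \<open>\<gamma> \<noteq> 1\<close> has no fixed corner, so it would rotate the corners \<open>a, b, c\<close>;
  then \<open>\<gamma>\<close> is a primitive cube root of unity and \<open>a + b + c = (1 + \<gamma> + \<gamma>\<^sup>2) * a = 0\<close>.\<close>

lemma triangle_stabilizer:
  assumes abc: "corners a b c" and \<gamma>: "\<gamma> \<noteq> 0"
    and eq: "triangle_on (\<gamma> * a) (\<gamma> * b) (\<gamma> * c) = triangle_on a b c"
  shows "\<gamma> = 1"
proof (rule ccontr)
  assume 1: "\<gamma> \<noteq> 1"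
  have C: "{\<gamma> * a, \<gamma> * b, \<gamma> * c} = {a, b, c}"
    using corners_eq[OF abc] corners_eq[OF corners_scale[OF \<gamma> abc]] unfolding eq by simp
  have ne: "\<gamma> * x \<noteq> x" if "x \<noteq> 0" for x using 1 that by simp
  have nz: "a \<noteq> 0" "b \<noteq> 0" "c \<noteq> 0" and d: "a \<noteq> b" "b \<noteq> c" "c \<noteq> a" using abc by (auto simp: corners_def)
  have in_C: "\<gamma> * a \<in> {a, b, c}" "\<gamma> * b \<in> {a, b, c}" "\<gamma> * c \<in> {a, b, c}" using C by blast+
  have inj: "\<gamma> * a \<noteq> \<gamma> * b" "\<gamma> * b \<noteq> \<gamma> * c" "\<gamma> * c \<noteq> \<gamma> * a" using d \<gamma> by auto
  have "\<gamma> * a = b \<and> \<gamma> * b = c \<and> \<gamma> * c = a \<or> \<gamma> * a = c \<and> \<gamma> * c = b \<and> \<gamma> * b = a"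
    using in_C inj ne[OF nz(1)] ne[OF nz(2)] ne[OF nz(3)] by auto
  then have "\<gamma> * (a + b + c) = a + b + c" by (auto simp: distrib_left ac_simps)
  moreover have "a + b + c \<noteq> 0" using abc by (simp add: corners_def)
  ultimately show False using ne by blast
qed

end

section \<open>The spread\<close>

locale spread = binary_field +
  fixes m :: nat and g :: int
  assumes dvd: "m dvd n" and g: "g = (2 ^ n - 1) div (2 ^ m - 1)"
begin

text \<open>The fixed points of the \<open>m\<close>-fold Frobenius map, a concrete form of the
  subfield that \<open>subfield_of_order\<close> only describes.\<close>

definition K :: "'a set" where
  "K = {x. x ^ 2 ^ m = x}"

lemma power_add_two_power: "(x + y) ^ 2 ^ i = x ^ 2 ^ i + (y :: 'a) ^ 2 ^ i"
proof (induction i)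
  case (Suc i)
  have "(x + y) ^ 2 ^ Suc i = ((x + y) ^ 2 ^ i)\<^sup>2" by (simp add: mult.commute flip: power_mult)
  also have "\<dots> = (x ^ 2 ^ i)\<^sup>2 + (y ^ 2 ^ i)\<^sup>2"
    unfolding Suc power2_eq_square by (simp add: distrib_left distrib_right ac_simps del: mult_2 mult_2_right)
  finally show ?case by (simp add: mult.commute flip: power_mult)
qed simp

lemma subfield_K: "is_subfield K"
  by (auto simp: is_subfield_def K_def power_add_two_power power_mult_distrib power_inverse)

lemma m_pos: "0 < m"
  using dvd n_pos by (auto intro: Nat.gr0I)

text \<open>For \<open>n = m * k\<close> this is the divisibility of \<open>q ^ k - 1\<close> by
  \<open>q - 1\<close> at \<open>q = 2 ^ m\<close>, so the division in \<open>g\<close> is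
  exact.\<close>

lemma g_mult: "g * (2 ^ m - 1) = 2 ^ n - 1"
proof -
  obtain k where k: "n = m * k" using dvd ..
  have "(2 :: int) ^ m - 1 dvd (2 ^ m) ^ k - 1"
    using power_diff_1_eq[of "(2 :: int) ^ m" k] by simp
  then show ?thesis by (simp add: g k power_mult)
qed

lemma two_m: "(2 :: int) ^ m - 1 > 0"
  using one_less_power[of "2 :: int", OF _ m_pos] by simp

lemma g_pos: "g > 0"
proof -
  have "g * (2 ^ m - 1) > 0" using g_mult n_pos one_less_power[of "2 :: int", OF _ n_pos] by simp
  then show ?thesis using two_m by (simp add: zero_less_mult_iff)
qed

lemma multiples_eq: "multiples n g = {k \<in> exponents n. g dvd k}"
proof (intro equalityI subsetI)
  fix k assume "k \<in> multiples n g"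
  then obtain j where k: "k = (g * j) mod (2 ^ n - 1)" by (auto simp: multiples_def)
  have "g dvd 2 ^ n - 1" using g_mult by (metis dvd_triv_left)
  then have "g dvd k" unfolding k by (simp add: dvd_mod)
  then show "k \<in> {k \<in> exponents n. g dvd k}" using k by simp
next
  fix k assume "k \<in> {k \<in> exponents n. g dvd k}"
  then obtain j where k: "k = g * j" and e: "k \<in> exponents n" by auto
  have "0 \<le> j" using k e g_pos by (simp add: exponents_def zero_le_mult_iff)
  \<comment> \<open>The quotient is no larger than \<open>k\<close>, so it is itself one of the
    representatives over which \<open>multiples\<close> ranges.\<close>
  moreover have "j \<le> k" unfolding k using g_pos \<open>0 \<le> j\<close> by (simp add: mult_le_cancel_right1)
  ultimately have "j \<in> exponents n" using e by (simp add: exponents_def)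
  then show "k \<in> multiples n g" using mod_exponents[OF e] k unfolding multiples_def by (metis imageI)
qed

text \<open>Being fixed by the Frobenius power means that \<open>k * (2 ^ m - 1)\<close> vanishes
  modulo \<open>g * (2 ^ m - 1)\<close>; cancel the common factor.\<close>

lemma powi_in_K_iff: "\<xi> powi k \<in> K \<longleftrightarrow> g dvd k"
proof -
  have "\<xi> powi k \<in> K \<longleftrightarrow> \<xi> powi (k * 2 ^ m) = \<xi> powi k"
    by (simp add: K_def power_int_mult flip: power_int_of_nat)
  also have "\<dots> \<longleftrightarrow> (2 ^ n - 1) dvd k * 2 ^ m - k"
    unfolding powi_eq_iff by (simp add: mod_eq_dvd_iff)
  also have "k * 2 ^ m - k = k * (2 ^ m - 1)" by (simp add: algebra_simps)
  also have "(2 ^ n - 1 :: int) = g * (2 ^ m - 1)" by (simp add: g_mult)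
  also have "g * (2 ^ m - 1) dvd k * (2 ^ m - 1) \<longleftrightarrow> g dvd k" using two_m by simp
  finally show ?thesis .
qed

lemma exponents_diff_multiples: "exponents n - multiples n g = log_set (- K)"
  by (auto simp: multiples_eq log_set_def powi_in_K_iff)

text \<open>The logarithms of the nonzero elements are the products \<open>g * j\<close> with
  \<open>j\<close> below \<open>2 ^ m - 1\<close>; the element 0 is the remaining one.\<close>

lemma card_K: "card K = 2 ^ m"
proof -
  have 0: "0 \<in> K" using subfield_K by (simp add: is_subfield_def)
  have "log_set (K - {0}) = (\<lambda>j. g * j) ` {0..<2 ^ m - 1}"
  proof (intro equalityI subsetI)
    fix k assume "k \<in> log_set (K - {0})"
    then have k: "k \<in> exponents n" "g dvd k" by (auto simp: log_set_def powi_in_K_iff)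
    then obtain j where j: "k = g * j" by auto
    have "0 \<le> j" using k j g_pos by (simp add: exponents_def zero_le_mult_iff)
    moreover have "g * j < g * (2 ^ m - 1)" using k j by (simp add: exponents_def g_mult)
    ultimately show "k \<in> (\<lambda>j. g * j) ` {0..<2 ^ m - 1}" using j g_pos by (simp add: mult_less_cancel_left_pos)
  next
    fix k assume "k \<in> (\<lambda>j. g * j) ` {0..<2 ^ m - 1}"
    then obtain j where j: "k = g * j" and "j \<in> {0..<2 ^ m - 1}" by (rule imageE)
    then have "0 \<le> j" "j < 2 ^ m - 1" by simp_all
    then have "k < g * (2 ^ m - 1)" using j g_pos by (simp add: mult_less_cancel_left_pos)
    then have "k \<in> exponents n" using j \<open>0 \<le> j\<close> g_pos by (simp add: g_mult exponents_def)
    then show "k \<in> log_set (K - {0})" using j by (simp add: log_set_def powi_in_K_iff)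
  qed
  moreover have "card ((\<lambda>j. g * j) ` {0..<2 ^ m - 1}) = 2 ^ m - 1"
  proof -
    have "int (2 ^ m - 1) = 2 ^ m - 1" by (simp add: of_nat_diff)
    then have "card {0..<2 ^ m - 1 :: int} = 2 ^ m - 1" by (metis card_atLeastLessThan_int diff_zero nat_int)
    moreover have "inj_on (\<lambda>j. g * j) {0..<2 ^ m - 1}" using g_pos by (simp add: inj_on_def)
    ultimately show ?thesis by (simp only: card_image)
  qed
  ultimately have "card (K - {0}) = 2 ^ m - 1" using card_log_set[of "K - {0}"] by simp
  then have "card K - 1 = 2 ^ m - 1" using 0 by simp
  moreover have "card K > 0" using 0 by (auto simp: card_gt_0_iff)
  ultimately show ?thesis
    using one_less_power[of "2 :: nat", OF _ m_pos] by simp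
qed

text \<open>Every element of a subfield of this order is a root of the equation defining
  \<open>K\<close>, so the subfield lies in \<open>K\<close> and equals it by size. This makes the
  description in \<open>subfield_of_order\<close> definite.\<close>

lemma subfield_of_order_eq: "subfield_of_order (2 ^ m) = K"
  unfolding subfield_of_order_def
proof (rule the_equality)
  fix M :: "'a set" assume M: "is_subfield M \<and> card M = 2 ^ m"
  have "x \<in> K" if "x \<in> M" for x
  proof (cases "x = 0")
    case False
    have "x ^ (2 ^ m - 1) = 1" using subfield_power_card[of M x] M that False by simp
    then have "x * x ^ (2 ^ m - 1) = x" by simp
    then have "x ^ Suc (2 ^ m - 1) = x" by (simp only: power_Suc)
    then show ?thesis by (simp add: K_def)
  qed (simp add: K_def)
  then show "M = K" using M card_K by (intro card_subset_eq) auto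
qed (use subfield_K card_K in blast)

abbreviation G :: "'a set set" where
  "G \<equiv> desarguesian_spread m"

lemma spread_eq: "G = {(\<lambda>y. a * y) ` K | a. a \<noteq> 0}"
  by (simp add: desarguesian_spread_def subfield_of_order_eq)

lemma spread_ex1:
  assumes "x \<noteq> 0"
  shows "\<exists>!U. U \<in> G \<and> x \<in> U"
proof (rule ex1I[of _ "(\<lambda>y. x * y) ` K"])
  have "1 \<in> K" by (simp add: K_def)
  then have "x \<in> (\<lambda>y. x * y) ` K" by force
  then show "(\<lambda>y. x * y) ` K \<in> G \<and> x \<in> (\<lambda>y. x * y) ` K" using assms unfolding spread_eq by blast
next
  fix U assume "U \<in> G \<and> x \<in> U"
  then obtain a where "U = (\<lambda>y. a * y) ` K" "x \<in> (\<lambda>y. a * y) ` K" unfolding spread_eq by blast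
  then show "U = (\<lambda>y. x * y) ` K" using subfield_coset_eq[OF subfield_K _ assms] by simp
qed

lemma spread_subspace:
  assumes "U \<in> G"
  shows "f2.subspace U \<and> f2.dim U = m"
proof -
  obtain a where a: "a \<noteq> 0" "U = (\<lambda>y. a * y) ` K" using assms by (auto simp: spread_eq)
  have "f2.subspace U"
    using subfield_K unfolding f2_subspace_iff a(2)
    by (auto simp: is_subfield_def simp flip: distrib_left)
  moreover have "card U = 2 ^ m"
    unfolding a(2) using a(1) card_K by (subst card_image) (auto simp: inj_on_def)
  ultimately show ?thesis using f2_dim_eqI by blast
qed

text \<open>Divided by \<open>v\<close>, the line becomes \<open>{0, x, 1, x + 1}\<close>, which
  lies in \<open>K\<close> as soon as \<open>x\<close> does. One ratio decides, so the ratios of a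
  line are all in \<open>K\<close> or all outside.\<close>

lemma line_in_group_iff:
  assumes L: "L \<in> lines" and x: "x \<in> ratios L"
  shows "(\<exists>U\<in>G. L \<subseteq> U) \<longleftrightarrow> x \<in> K"
proof -
  obtain u v where uv: "u \<in> L" "v \<in> L" "u \<noteq> 0" "v \<noteq> 0" "u \<noteq> v" "x = u / v"
    using x by (auto simp: ratios_def)
  show ?thesis
  proof
    assume "\<exists>U\<in>G. L \<subseteq> U"
    then obtain a where a: "L \<subseteq> (\<lambda>y. a * y) ` K" by (auto simp: spread_eq)
    then have "v \<in> (\<lambda>y. a * y) ` K" using uv by blast
    from subfield_coset_eq[OF subfield_K this uv(4)] a uv obtain k where "k \<in> K" "u = v * k" by auto
    then show "x \<in> K" using uv by simp
  next
    assume "x \<in> K"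
    moreover have "0 \<in> K" "1 \<in> K" using subfield_K by (auto simp: is_subfield_def)
    moreover from calculation have "x + 1 \<in> K" using subfield_K by (auto simp: is_subfield_def)
    moreover have "L = (\<lambda>y. v * y) ` {0, x, 1, x + 1}"
      using line_eq[OF L uv(1-5)] uv by (simp add: distrib_left)
    ultimately have "L \<subseteq> (\<lambda>y. v * y) ` K" by blast
    then show "\<exists>U\<in>G. L \<subseteq> U" unfolding spread_eq using uv by blast
  qed
qed

end

section \<open>The action on triangles\<close>

definition act :: "'a::field \<Rightarrow> 'a set set \<Rightarrow> 'a set set" where
  "act \<gamma> T = (\<lambda>L. (\<lambda>y. \<gamma> * y) ` L) ` T"

lemma act_act: "act \<gamma> (act \<delta> T) = act (\<gamma> * \<delta>) T"
  by (simp add: act_def image_image mult.assoc)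

lemma act_1 [simp]: "act 1 T = T"
  by (simp add: act_def)

lemma act_memI: "L \<in> T \<Longrightarrow> (\<lambda>y. \<gamma> * y) ` L \<in> act \<gamma> T"
  by (simp add: act_def)

lemma mult_invariantD: "mult_invariant B \<Longrightarrow> \<gamma> \<noteq> 0 \<Longrightarrow> T \<in> B \<Longrightarrow> act \<gamma> T \<in> B"
  unfolding mult_invariant_def act_def by blast

text \<open>Multiplication by \<open>y / x\<close> maps the triangles covering \<open>x\<close>
  injectively to those covering \<open>y\<close>; exchanging \<open>x\<close> and \<open>y\<close>
  gives the other inequality.\<close>

lemma balanced_if_mult_invariant:
  fixes B :: "'a::{field,finite} set set set"
  assumes B: "mult_invariant B"
  shows "balanced UNIV B"
proof -
  have le: "card {T \<in> B. covers T x} \<le> card {T \<in> B. covers T y}" if xy: "x \<noteq> 0" "y \<noteq> 0" for x y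
  proof (rule card_inj_on_le)
    show "inj_on (act (y / x)) {T \<in> B. covers T x}"
    proof (rule inj_onI)
      fix T T' assume "act (y / x) T = act (y / x) T'"
      then have "act (x / y) (act (y / x) T) = act (x / y) (act (y / x) T')" by simp
      then show "T = T'" using xy by (simp add: act_act)
    qed
    show "act (y / x) ` {T \<in> B. covers T x} \<subseteq> {T \<in> B. covers T y}"
    proof clarify
      fix T assume T: "T \<in> B" "covers T x"
      then obtain L where L: "L \<in> T" "x \<in> L" by (auto simp: covers_def)
      have "y / x * x \<in> (\<lambda>z. y / x * z) ` L" using L by blast
      then have "y \<in> (\<lambda>z. y / x * z) ` L" using xy by simp
      then have "covers (act (y / x) T) y" using act_memI[OF L(1)] unfolding covers_def by blast
      moreover have "act (y / x) T \<in> B" using mult_invariantD[OF B] T xy by simp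
      ultimately show "act (y / x) T \<in> B \<and> covers (act (y / x) T) y" by blast
    qed
  qed simp
  have "card {T \<in> B. covers T x} = card {T \<in> B. covers T 1}" if "x \<noteq> 0" for x
    using le[of x 1] le[of 1 x] that by simp
  then show ?thesis unfolding balanced_def by blast
qed

section \<open>Designs and partitions\<close>

lemma card_disjoint_18:
  assumes "card A = 6" "card B = 6" "card C = 6" "A \<inter> B = {}" "A \<inter> C = {}" "B \<inter> C = {}"
  shows "card (A \<union> B \<union> C) = 18"
proof -
  have "finite A" "finite B" "finite C" using assms by (auto intro: card_ge_0_finite)
  then show ?thesis using assms by (simp add: card_Un_disjoint Int_Un_distrib2)
qed

text \<open>Three sets of at most six elements reach 18 only if each has exactly six.\<close>

lemma card_Un3_eq_18:
  assumes "card (A \<union> B \<union> C) = 18" "card A \<le> 6" "card B \<le> 6" "card C \<le> 6"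
  shows "card A = 6" "card B = 6" "card C = 6"
  using card_Un_le[of "A \<union> B" C] card_Un_le[of A B] assms by linarith+

context spread
begin

definition design :: "'a set set set \<Rightarrow> bool" where
  "design B \<longleftrightarrow> gd_triangle_design f2_scale n m UNIV G B"

text \<open>The spread meets the conditions on groups, which leaves conditions on \<open>B\<close>
  alone. A nonzero point of a line lies in just one group, which turns existence of a group around
  the line into unique existence.\<close>

lemma design_iff:
  "design B \<longleftrightarrow>
    (\<forall>T\<in>B. \<exists>a b c. corners a b c \<and> T = triangle_on a b c) \<and>
    (\<forall>L\<in>lines. (\<exists>!T. T \<in> B \<and> L \<in> T) \<and> \<not> (\<exists>U\<in>G. L \<subseteq> U) \<or>
      \<not> (\<exists>T\<in>B. L \<in> T) \<and> (\<exists>U\<in>G. L \<subseteq> U))"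
proof -
  have ex1: "(\<exists>!U. U \<in> G \<and> L \<subseteq> U) \<longleftrightarrow> (\<exists>U\<in>G. L \<subseteq> U)" if L: "L \<in> lines" for L
  proof -
    obtain u where "u \<in> L" "u \<noteq> 0" using line_nonzero[OF L] by blast
    then show ?thesis using spread_ex1[of u] by blast
  qed
  have lines: "(\<forall>L. L \<subseteq> UNIV \<and> f2.subspace L \<and> f2.dim L = 2 \<longrightarrow> Q L) \<longleftrightarrow> (\<forall>L\<in>lines. Q L)" for Q
    using f2_line_iff by auto
  have dim: "f2.dim UNIV = n"
    using f2_dim_eqI[OF f2.subspace_UNIV card_field] .
  \<comment> \<open>Stated as equations with \<open>True\<close> so that unfolding can replace the
    group conditions inside the definition.\<close>
  have "(\<forall>U\<in>G. U \<subseteq> UNIV \<and> f2.subspace U \<and> f2.dim U = m) = True"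
    "(\<forall>x\<in>UNIV - {0}. \<exists>!U. U \<in> G \<and> x \<in> U) = True"
    using spread_subspace spread_ex1 by simp_all
  note groups = this[THEN eq_reflection]
  have "design B \<longleftrightarrow> (\<forall>T\<in>B. triangle f2_scale UNIV T) \<and>
    (\<forall>L\<in>lines. (\<exists>!T. T \<in> B \<and> L \<in> T) \<and> \<not> (\<exists>U\<in>G. L \<subseteq> U) \<or>
      \<not> (\<exists>T\<in>B. L \<in> T) \<and> (\<exists>!U. U \<in> G \<and> L \<subseteq> U))"
    unfolding design_def gd_triangle_design_def lines groups
    by (simp only: f2.vector_space_axioms dvd f2.subspace_UNIV dim finite simp_thms)
  then show ?thesis
    unfolding triangle_iff using ex1 by (simp cong: ball_cong)
qed

definition X :: "int set" where
  "X = exponents n - multiples n g"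

lemma X_eq: "X = log_set (- K)"
  by (simp add: X_def exponents_diff_multiples)

lemma zero_one_in_K [simp]: "0 \<in> K" "1 \<in> K"
  using subfield_K by (auto simp: is_subfield_def)

text \<open>Since 1 belongs to \<open>K\<close>, an exponent in \<open>X\<close> never gives 1, and
  the Zech logarithms in question exist.\<close>

lemma Gam_ratios:
  assumes "k \<in> X" "a / b = \<xi> powi k" "b \<noteq> 0"
  shows "Gam n \<xi> k = log_set (ratios {0, a, b, a + b})"
proof (rule Gam_eq)
  show "\<xi> powi k \<noteq> 1" using assms(1) zero_one_in_K by (auto simp: X_eq log_set_def)
qed fact+

lemma Gam_line:
  assumes "k \<in> X"
  obtains L where "L \<in> lines" "\<xi> powi k \<in> ratios L" "Gam n \<xi> k = log_set (ratios L)"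
proof
  let ?L = "{0, \<xi> powi k, 1, \<xi> powi k + 1}"
  have 1: "\<xi> powi k \<noteq> 1" using assms zero_one_in_K by (auto simp: X_eq log_set_def)
  then show "?L \<in> lines" by (intro lineI) auto
  show "\<xi> powi k \<in> ratios ?L" unfolding ratios_def using 1
    by (intro CollectI exI[of _ "\<xi> powi k"] exI[of _ 1]) simp
  show "Gam n \<xi> k = log_set (ratios ?L)" by (rule Gam_ratios) (use assms in auto)
qed

lemma Gam_self: "k \<in> X \<Longrightarrow> k \<in> Gam n \<xi> k"
  by (metis (mono_tags, lifting) Gam_line X_def DiffD1 log_set_def mem_Collect_eq)

lemma ratios_subset:
  assumes "L \<in> lines" "x \<in> ratios L" "x \<notin> K"
  shows "ratios L \<subseteq> - K"
  using line_in_group_iff[OF assms(1)] assms(2,3) by blast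

lemma Gam_subset: "k \<in> X \<Longrightarrow> Gam n \<xi> k \<subseteq> X"
proof -
  assume k: "k \<in> X"
  then obtain L where L: "L \<in> lines" "\<xi> powi k \<in> ratios L" "Gam n \<xi> k = log_set (ratios L)"
    by (rule Gam_line)
  have "\<xi> powi k \<notin> K" using k by (auto simp: X_eq log_set_def)
  from ratios_subset[OF L(1,2) this] show ?thesis unfolding L(3) X_eq by (auto simp: log_set_def)
qed

lemma card_Gam_le: "k \<in> X \<Longrightarrow> card (Gam n \<xi> k) \<le> 6"
  by (metis Gam_line card_log_set card_ratios_le ratios_nonzero)

text \<open>With \<open>Gam_self\<close> and \<open>Gam_subset\<close> this makes the \<Gamma>-sets
  the classes of an equivalence relation on \<open>X\<close>, one for each homothety class of lines
  outside the groups.\<close>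

lemma Gam_eqI:
  assumes "k \<in> X" "j \<in> X" "i \<in> Gam n \<xi> k" "i \<in> Gam n \<xi> j"
  shows "Gam n \<xi> k = Gam n \<xi> j"
proof -
  obtain L where L: "L \<in> lines" "Gam n \<xi> k = log_set (ratios L)"
    using assms(1) by (rule Gam_line)
  obtain M where M: "M \<in> lines" "Gam n \<xi> j = log_set (ratios M)"
    using assms(2) by (rule Gam_line)
  have "\<xi> powi i \<in> ratios L" "\<xi> powi i \<in> ratios M" using assms L M by (auto simp: log_set_def)
  with L M show ?thesis using ratios_eqI by metis
qed

section \<open>Blocks and the triangles that yield them\<close>

definition block :: "int set \<Rightarrow> bool" where
  "block S \<longleftrightarrow> card S = 18 \<and>
    (\<exists>k1\<in>X. \<exists>k2\<in>X. \<exists>k3\<in>X.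
      S = Gam n \<xi> k1 \<union> Gam n \<xi> k2 \<union> Gam n \<xi> k3 \<and>
      Gam n \<xi> k1 \<inter> Gam n \<xi> k2 = {} \<and> Gam n \<xi> k1 \<inter> Gam n \<xi> k3 = {} \<and>
      Gam n \<xi> k2 \<inter> Gam n \<xi> k3 = {} \<and>
      (k1 + k2 + k3) mod (2 ^ n - 1) = 0)"

lemma blockI:
  assumes "card S = 18" "k1 \<in> X" "k2 \<in> X" "k3 \<in> X"
    "S = Gam n \<xi> k1 \<union> Gam n \<xi> k2 \<union> Gam n \<xi> k3"
    "Gam n \<xi> k1 \<inter> Gam n \<xi> k2 = {}" "Gam n \<xi> k1 \<inter> Gam n \<xi> k3 = {}"
    "Gam n \<xi> k2 \<inter> Gam n \<xi> k3 = {}" "(k1 + k2 + k3) mod (2 ^ n - 1) = 0"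
  shows "block S"
  unfolding block_def
  by (intro conjI bexI[of _ k1] bexI[of _ k2] bexI[of _ k3]) fact+

lemma blockE:
  assumes "block S"
  obtains k1 k2 k3 where "k1 \<in> X" "k2 \<in> X" "k3 \<in> X"
    "S = Gam n \<xi> k1 \<union> Gam n \<xi> k2 \<union> Gam n \<xi> k3" "card S = 18"
    "Gam n \<xi> k1 \<inter> Gam n \<xi> k2 = {}" "Gam n \<xi> k1 \<inter> Gam n \<xi> k3 = {}"
    "Gam n \<xi> k2 \<inter> Gam n \<xi> k3 = {}" "(k1 + k2 + k3) mod (2 ^ n - 1) = 0"
  using assms unfolding block_def by (elim conjE bexE)

text \<open>A triangle fit to represent an orbit. Six ratios mean that a side has trivial
  stabilizer, ratios outside \<open>K\<close> that no group contains it, and disjoint ratio sets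
  that different sides lie in different orbits.\<close>

definition base_triangle :: "'a set set \<Rightarrow> bool" where
  "base_triangle T \<longleftrightarrow>
    (\<exists>a b c. corners a b c \<and> T = triangle_on a b c) \<and>
    (\<forall>L\<in>T. card (ratios L) = 6 \<and> ratios L \<subseteq> - K) \<and>
    (\<forall>L\<in>T. \<forall>M\<in>T. L \<noteq> M \<longrightarrow> ratios L \<inter> ratios M = {})"

text \<open>Homotheties keep ratios, so this depends only on the orbit of the triangle; it will be
  the block of that orbit.\<close>

definition log_ratios :: "'a set set \<Rightarrow> int set" where
  "log_ratios T = log_set (\<Union>L\<in>T. ratios L)"

lemma log_set_disjoint: "A \<inter> B = {} \<Longrightarrow> log_set A \<inter> log_set B = {}"
  by (auto simp: log_set_def)

lemma log_ratios_triangle_on: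
  "log_ratios (triangle_on a b c) =
    log_set (ratios {0, a, b, a + b}) \<union> log_set (ratios {0, b, c, b + c}) \<union>
    log_set (ratios {0, c, a, c + a})"
  unfolding log_ratios_def triangle_on_def by (auto simp: log_set_def)

lemma ratio_in_ratios: "a \<noteq> 0 \<Longrightarrow> b \<noteq> 0 \<Longrightarrow> a \<noteq> b \<Longrightarrow> a / b \<in> ratios {0, a, b, a + b}"
  unfolding ratios_def by blast

lemma block_log_ratios:
  assumes "base_triangle T"
  shows "block (log_ratios T)"
proof -
  obtain a b c where abc: "corners a b c" "T = triangle_on a b c"
    using assms unfolding base_triangle_def by (elim conjE exE)
  have *: "card (ratios L) = 6" "ratios L \<subseteq> - K" if "L \<in> T" for L
    using assms that by (simp_all add: base_triangle_def)
  have dis: "ratios L \<inter> ratios M = {}" if "L \<in> T" "M \<in> T" "L \<noteq> M" for L M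
    using assms that by (simp add: base_triangle_def)
  let ?L = "{0, a, b, a + b}" and ?M = "{0, b, c, b + c}" and ?N = "{0, c, a, c + a}"
  have nz: "a \<noteq> 0" "b \<noteq> 0" "c \<noteq> 0" "a \<noteq> b" "b \<noteq> c" "c \<noteq> a" using abc(1) by (auto simp: corners_def)
  have mem: "?L \<in> T" "?M \<in> T" "?N \<in> T" by (simp_all add: abc triangle_on_def)
  have "a / b \<noteq> 0" "b / c \<noteq> 0" "c / a \<noteq> 0" using nz by auto
  then obtain k1 k2 k3 where k: "k1 \<in> exponents n" "\<xi> powi k1 = a / b"
    "k2 \<in> exponents n" "\<xi> powi k2 = b / c" "k3 \<in> exponents n" "\<xi> powi k3 = c / a"
    using ex_log by metis
  have "a / b \<notin> K" "b / c \<notin> K" "c / a \<notin> K"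
    using *(2)[OF mem(1)] *(2)[OF mem(2)] *(2)[OF mem(3)] ratio_in_ratios nz by blast+
  then have X: "k1 \<in> X" "k2 \<in> X" "k3 \<in> X" using k by (auto simp: X_eq log_set_def)
  note Gam = Gam_ratios[OF X(1) k(2)[symmetric] nz(2)] Gam_ratios[OF X(2) k(4)[symmetric] nz(3)]
    Gam_ratios[OF X(3) k(6)[symmetric] nz(1)]
  have card6: "card (log_set (ratios ?L)) = 6" "card (log_set (ratios ?M)) = 6" "card (log_set (ratios ?N)) = 6"
    using *(1) mem by (auto simp: card_log_set ratios_nonzero)
  note ne = corners_distinct_lines[OF abc(1)]
  have disj: "log_set (ratios ?L) \<inter> log_set (ratios ?M) = {}"
    "log_set (ratios ?L) \<inter> log_set (ratios ?N) = {}"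
    "log_set (ratios ?M) \<inter> log_set (ratios ?N) = {}"
    using dis[OF mem(1,2) ne(1)] dis[OF mem(1,3) ne(3)] dis[OF mem(2,3) ne(2)]
    by (auto intro!: log_set_disjoint)
  have "\<xi> powi (k1 + k2 + k3) = 1" using k nz by (simp add: power_int_add)
  then have "(k1 + k2 + k3) mod (2 ^ n - 1) = 0" by (simp only: powi_eq_1_iff)
  moreover have "card (log_ratios T) = 18"
    unfolding abc(2) log_ratios_triangle_on using card_disjoint_18[OF card6 disj] .
  moreover have "log_ratios T = Gam n \<xi> k1 \<union> Gam n \<xi> k2 \<union> Gam n \<xi> k3"
    unfolding abc(2) log_ratios_triangle_on Gam ..
  ultimately show ?thesis
    using X disj[folded Gam] by (intro blockI)
qed

lemma block_ex_triangle:
  assumes "block S"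
  obtains T where "base_triangle T" "log_ratios T = S"
proof -
  obtain k1 k2 k3 where X: "k1 \<in> X" "k2 \<in> X" "k3 \<in> X"
    and S: "S = Gam n \<xi> k1 \<union> Gam n \<xi> k2 \<union> Gam n \<xi> k3" "card S = 18"
    and disj: "Gam n \<xi> k1 \<inter> Gam n \<xi> k2 = {}" "Gam n \<xi> k1 \<inter> Gam n \<xi> k3 = {}"
      "Gam n \<xi> k2 \<inter> Gam n \<xi> k3 = {}"
    and sum: "(k1 + k2 + k3) mod (2 ^ n - 1) = 0"
    using assms by (rule blockE)
  \<comment> \<open>Up to homothety the cyclic ratios force the corners: \<open>c = 1\<close>, then
    \<open>b\<close> with logarithm \<open>k2\<close> and \<open>a\<close> with logarithm
    \<open>k1 + k2\<close>. The third ratio comes out right because the exponents sum to 0.\<close>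
  let ?c = "1 :: 'a"
  define b where "b = \<xi> powi k2"
  define a where "a = \<xi> powi k1 * b"
  have nz: "a \<noteq> 0" "b \<noteq> 0" by (auto simp: a_def b_def)
  have "\<xi> powi (k1 + k2 + k3) = 1" using sum by (simp only: powi_eq_1_iff)
  then have "a * \<xi> powi k3 = 1" by (simp add: a_def b_def power_int_add)
  then have r: "a / b = \<xi> powi k1" "b / ?c = \<xi> powi k2" "?c / a = \<xi> powi k3"
    using nz by (auto simp: a_def b_def field_simps)
  let ?L = "{0, a, b, a + b}" and ?M = "{0, b, ?c, b + ?c}" and ?N = "{0, ?c, a, ?c + a}"
  note Gam = Gam_ratios[OF X(1) r(1) nz(2)] Gam_ratios[OF X(2) r(2) one_neq_zero]
    Gam_ratios[OF X(3) r(3) nz(1)]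
  have notK: "a / b \<notin> K" "b / ?c \<notin> K" "?c / a \<notin> K"
    unfolding r using X by (auto simp: X_eq log_set_def)
  then have ne: "a \<noteq> b" "b \<noteq> ?c" "?c \<noteq> a" using nz by auto
  \<comment> \<open>Otherwise the three points form one line, whose ratios would give both
    \<Gamma>(\<open>k1\<close>) and \<Gamma>(\<open>k2\<close>), although these are disjoint and
    nonempty.\<close>
  have "a + b + ?c \<noteq> 0"
  proof
    assume "a + b + ?c = 0"
    then have c: "a + b = ?c" by simp
    then have "b + ?c = a" by (metis add.commute add_self_left)
    then have "?M = ?L" unfolding c by (simp only: insert_commute)
    then have "Gam n \<xi> k1 = Gam n \<xi> k2" unfolding Gam by simp
    with disj Gam_self X show False by blast
  qed
  then have corners: "corners a b ?c" using nz ne by (simp add: corners_def)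
  let ?T = "triangle_on a b ?c"
  have S_eq: "log_ratios ?T = S" unfolding S(1) Gam log_ratios_triangle_on ..
  have "card (Gam n \<xi> k1) = 6" "card (Gam n \<xi> k2) = 6" "card (Gam n \<xi> k3) = 6"
    using card_Un3_eq_18[OF S(2)[unfolded S(1)]] card_Gam_le X by blast+
  then have card6: "card (ratios ?L) = 6" "card (ratios ?M) = 6" "card (ratios ?N) = 6"
    unfolding Gam by (simp_all only: card_log_set ratios_nonzero not_False_eq_True)
  have lines: "?L \<in> lines" "?M \<in> lines" "?N \<in> lines" using corners triangle_on_lines
    by (auto simp: triangle_on_def)
  have sub: "ratios ?L \<subseteq> - K" "ratios ?M \<subseteq> - K" "ratios ?N \<subseteq> - K"
    using ratios_subset[OF lines(1) _ notK(1)] ratios_subset[OF lines(2) _ notK(2)]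
      ratios_subset[OF lines(3) _ notK(3)] ratio_in_ratios nz ne one_neq_zero by metis+
  \<comment> \<open>Every ratio is nonzero and has a logarithm, so disjointness passes back from
    exponents to field elements.\<close>
  have dis: "ratios A \<inter> ratios B = {}" if "log_set (ratios A) \<inter> log_set (ratios B) = {}" for A B
  proof (rule ccontr)
    assume "ratios A \<inter> ratios B \<noteq> {}"
    then obtain x where x: "x \<in> ratios A" "x \<in> ratios B" by blast
    then have "x \<noteq> 0" using ratios_nonzero by metis
    then obtain k where "k \<in> exponents n" "\<xi> powi k = x" using ex_log by blast
    with x that show False by (auto simp: log_set_def)
  qed
  have disr: "ratios ?L \<inter> ratios ?M = {}" "ratios ?L \<inter> ratios ?N = {}" "ratios ?M \<inter> ratios ?N = {}"
    using disj unfolding Gam by (auto intro!: dis)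
  have "base_triangle ?T"
    unfolding base_triangle_def
  proof (intro conjI)
    show "\<exists>a' b' c'. corners a' b' c' \<and> triangle_on a b ?c = triangle_on a' b' c'"
      using corners by blast
    show "\<forall>L\<in>?T. card (ratios L) = 6 \<and> ratios L \<subseteq> - K"
      unfolding triangle_on_def using card6 sub by (simp only: ball_simps)
    show "\<forall>L\<in>?T. \<forall>M\<in>?T. L \<noteq> M \<longrightarrow> ratios L \<inter> ratios M = {}"
    proof -
      have "\<forall>L\<in>{A, B, C}. \<forall>M\<in>{A, B, C}. L \<noteq> M \<longrightarrow> ratios L \<inter> ratios M = {}"
        if "ratios A \<inter> ratios B = {}" "ratios A \<inter> ratios C = {}" "ratios B \<inter> ratios C = {}" for A B C
        using that by (auto simp: Int_commute)
      from this[OF disr] show ?thesis unfolding triangle_on_def .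
    qed
  qed
  then show thesis using S_eq that by blast
qed

text \<open>The map \<open>log_ratios\<close> is constant on orbits of triangles. Two triangles of
  \<open>B\<close> whose images meet share a ratio and therefore lie in one orbit, so distinct
  images are disjoint.\<close>

lemma design_block_partition:
  assumes B: "design B" and inv: "mult_invariant B"
  shows "partition_on X (log_ratios ` B) \<and> (\<forall>S\<in>log_ratios ` B. block S)"
proof -
  have tri: "\<exists>a b c. corners a b c \<and> T = triangle_on a b c" if "T \<in> B" for T
    using B that unfolding design_iff by blast
  note D = B[unfolded design_iff, THEN conjunct2, rule_format]
  have line: "L \<in> lines" if "T \<in> B" "L \<in> T" for T L
    using tri[OF that(1)] that(2) triangle_on_lines by blast
  have no_group: "\<not> (\<exists>U\<in>G. L \<subseteq> U)" if "T \<in> B" "L \<in> T" for T L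
    using D[OF line[OF that]] that by blast
  have uniq: "T = T'" if "T \<in> B" "T' \<in> B" "L \<in> T" "L \<in> T'" for T T' L
    using D[OF line[OF that(1,3)]] that by blast
  have stab: "\<gamma> = 1" if "T \<in> B" "\<gamma> \<noteq> 0" "act \<gamma> T = T" for T \<gamma>
    using tri[OF that(1)] that triangle_stabilizer unfolding act_def by (metis triangle_on_scale)
  \<comment> \<open>A homothety between the sides extends to the triangles: the image of
    \<open>T\<close> is in \<open>B\<close> by invariance and contains \<open>L'\<close>, and only
    one triangle does.\<close>
  have meet: "\<exists>\<gamma>. \<gamma> \<noteq> 0 \<and> L' = (\<lambda>y. \<gamma> * y) ` L \<and> T' = act \<gamma> T"
    if mem: "T \<in> B" "T' \<in> B" "L \<in> T" "L' \<in> T'" and x: "x \<in> ratios L" "x \<in> ratios L'"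
    for T T' L L' x
  proof -
    obtain \<gamma> where \<gamma>: "\<gamma> \<noteq> 0" "L' = (\<lambda>y. \<gamma> * y) ` L"
      using ratios_meet[OF line[OF mem(1,3)] line[OF mem(2,4)] x] .
    have "act \<gamma> T \<in> B" using mult_invariantD[OF inv \<gamma>(1) mem(1)] .
    moreover have "L' \<in> act \<gamma> T" unfolding \<gamma>(2) by (rule act_memI) fact
    ultimately have "T' = act \<gamma> T" using uniq mem by blast
    with \<gamma> show ?thesis by blast
  qed
  have base: "base_triangle T" if T: "T \<in> B" for T
    unfolding base_triangle_def
  proof (intro conjI ballI impI)
    show "\<exists>a b c. corners a b c \<and> T = triangle_on a b c" using tri[OF T] .
  next
    fix L assume L: "L \<in> T"
    \<comment> \<open>A homothety that fixes a side takes \<open>T\<close> to a triangle of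
      \<open>B\<close> through the same side, hence to \<open>T\<close>; the trivial stabilizer of
      triangles passes to their sides.\<close>
    have "\<gamma> = 1" if \<gamma>: "(\<lambda>y. \<gamma> * y) ` L = L" for \<gamma>
    proof -
      obtain u where "u \<in> L" "u \<noteq> 0" using line_nonzero[OF line[OF T L]] by blast
      then have "\<gamma> \<noteq> 0" using \<gamma> by force
      moreover from this have "act \<gamma> T = T"
        using uniq[OF mult_invariantD[OF inv _ T] T] act_memI[OF L, of \<gamma>] \<gamma> L by metis
      ultimately show ?thesis using stab T by blast
    qed
    then show "card (ratios L) = 6" using card_ratios_eq_6_iff[OF line[OF T L]] by blast
    show "ratios L \<subseteq> - K" using line_in_group_iff[OF line[OF T L]] no_group[OF T L] by blast
  next
    fix L M assume LM: "L \<in> T" "M \<in> T" "L \<noteq> M"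
    show "ratios L \<inter> ratios M = {}"
    proof (rule ccontr)
      assume "ratios L \<inter> ratios M \<noteq> {}"
      then obtain x where "x \<in> ratios L" "x \<in> ratios M" by blast
      \<comment> \<open>Here \<open>meet\<close> is used with both triangles equal: two sides in one
        orbit would give a homothety fixing \<open>T\<close>.\<close>
      from meet[OF T T LM(1,2) this]
      obtain \<gamma> where \<gamma>: "\<gamma> \<noteq> 0" "M = (\<lambda>y. \<gamma> * y) ` L" "T = act \<gamma> T" by blast
      then have "\<gamma> = 1" using stab[OF T] by metis
      with \<gamma> LM show False by simp
    qed
  qed
  have act_log: "log_ratios (act \<gamma> T) = log_ratios T" if "\<gamma> \<noteq> 0" for \<gamma> T
    using that by (simp add: log_ratios_def act_def ratios_scale)
  have "partition_on X (log_ratios ` B)"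
  proof (rule partition_onI)
    show "\<Union> (log_ratios ` B) = X"
    proof (intro equalityI subsetI)
      fix k assume "k \<in> \<Union> (log_ratios ` B)"
      then obtain T L where "T \<in> B" "L \<in> T" "\<xi> powi k \<in> ratios L" "k \<in> exponents n"
        by (auto simp: log_ratios_def log_set_def)
      then show "k \<in> X" using base unfolding base_triangle_def X_eq log_set_def by blast
    next
      fix k assume k: "k \<in> X"
      then obtain L where L: "L \<in> lines" "\<xi> powi k \<in> ratios L" by (rule Gam_line)
      have "\<xi> powi k \<notin> K" and e: "k \<in> exponents n" using k by (auto simp: X_eq log_set_def)
      then have "\<not> (\<exists>U\<in>G. L \<subseteq> U)" using line_in_group_iff[OF L] by simp
      then obtain T where "T \<in> B" "L \<in> T" using D[OF L(1)] by blast
      then show "k \<in> \<Union> (log_ratios ` B)" using L(2) e by (auto simp: log_ratios_def log_set_def)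
    qed
    show "disjnt S S'" if S: "S \<in> log_ratios ` B" "S' \<in> log_ratios ` B" "S \<noteq> S'" for S S'
    proof (rule ccontr)
      assume "\<not> disjnt S S'"
      moreover obtain T T' where T: "T \<in> B" "T' \<in> B" "S = log_ratios T" "S' = log_ratios T'"
        using S by blast
      ultimately obtain L L' x where "L \<in> T" "L' \<in> T'" "x \<in> ratios L" "x \<in> ratios L'"
        by (auto simp: disjnt_iff log_ratios_def log_set_def)
      from meet[OF T(1,2) this] act_log have "log_ratios T' = log_ratios T" by blast
      with T S show False by simp
    qed
    show "{} \<notin> log_ratios ` B"
    proof
      assume "{} \<in> log_ratios ` B"
      then obtain T where "T \<in> B" "{} = log_ratios T" by (rule imageE)
      then have "block {}" using block_log_ratios[OF base[OF \<open>T \<in> B\<close>]] by simp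
      then show False by (simp add: block_def)
    qed
  qed
  then show ?thesis using base block_log_ratios by blast
qed

lemma block_partition_design:
  assumes P: "partition_on X P" and block: "\<forall>S\<in>P. block S"
  shows "\<exists>B. design B \<and> mult_invariant B"
proof -
  have "\<forall>S\<in>P. \<exists>T. base_triangle T \<and> log_ratios T = S" using block block_ex_triangle by metis
  then obtain t where t: "\<And>S. S \<in> P \<Longrightarrow> base_triangle (t S)" "\<And>S. S \<in> P \<Longrightarrow> log_ratios (t S) = S"
    by metis
  \<comment> \<open>One full orbit per block. Adding a second orbit with the same block would put
    some line into two triangles.\<close>
  define B where "B = {act \<gamma> (t S) | \<gamma> S. \<gamma> \<noteq> 0 \<and> S \<in> P}"
  have corners: "\<exists>a b c. corners a b c \<and> t S = triangle_on a b c" if "S \<in> P" for S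
    using t(1)[OF that] by (simp add: base_triangle_def)
  have line: "L \<in> lines" if "S \<in> P" "L \<in> t S" for S L
    using corners[OF that(1)] that(2) triangle_on_lines by blast
  have sub: "ratios L \<subseteq> - K" and card6: "card (ratios L) = 6" if "S \<in> P" "L \<in> t S" for S L
    using t(1)[OF that(1)] that by (auto simp: base_triangle_def)
  have inB: "act \<gamma> T \<in> B" if "\<gamma> \<noteq> 0" "T \<in> B" for \<gamma> T
    using that unfolding B_def by (force simp: act_act)
  have mem_B: "\<exists>\<gamma> S M. \<gamma> \<noteq> 0 \<and> S \<in> P \<and> M \<in> t S \<and> T = act \<gamma> (t S) \<and> L = (\<lambda>y. \<gamma> * y) ` M"
    if "T \<in> B" "L \<in> T" for T L
    using that unfolding B_def act_def by blast
  have "mult_invariant B"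
    unfolding mult_invariant_def act_def[symmetric]
  proof (intro allI impI equalityI subsetI)
    fix \<gamma> :: 'a and T assume \<gamma>: "\<gamma> \<noteq> 0" and T: "T \<in> B"
    have "T = act \<gamma> (act (inverse \<gamma>) T)" using \<gamma> by (simp add: act_act)
    moreover have "act (inverse \<gamma>) T \<in> B" using inB T \<gamma> by simp
    ultimately show "T \<in> act \<gamma> ` B" by (rule image_eqI)
  qed (use inB in blast)
  moreover have "design B"
    unfolding design_iff
  proof (intro conjI ballI)
    fix T assume "T \<in> B"
    then obtain \<gamma> S where \<gamma>: "\<gamma> \<noteq> 0" "S \<in> P" "T = act \<gamma> (t S)" unfolding B_def by blast
    with corners[of S] show "\<exists>a b c. corners a b c \<and> T = triangle_on a b c"
      unfolding act_def by (metis triangle_on_scale corners_scale)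
  next
    fix L assume L: "L \<in> lines"
    then obtain a b where "a \<noteq> 0" "b \<noteq> 0" "a \<noteq> b" "L = {0, a, b, a + b}" by (auto simp: lines_def)
    then have "a / b \<in> ratios L" by (simp only: ratio_in_ratios not_False_eq_True)
    then obtain x where x: "x \<in> ratios L" ..
    show "(\<exists>!T. T \<in> B \<and> L \<in> T) \<and> \<not> (\<exists>U\<in>G. L \<subseteq> U) \<or>
      \<not> (\<exists>T\<in>B. L \<in> T) \<and> (\<exists>U\<in>G. L \<subseteq> U)"
    proof (cases "x \<in> K")
      case True
      have "\<not> (\<exists>T\<in>B. L \<in> T)"
      proof
        assume "\<exists>T\<in>B. L \<in> T"
        then obtain T where "T \<in> B" "L \<in> T" by (rule bexE)
        from mem_B[OF this] obtain \<gamma> S M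
          where M: "\<gamma> \<noteq> 0" "S \<in> P" "M \<in> t S" "L = (\<lambda>y. \<gamma> * y) ` M"
          by (elim exE conjE)
        \<comment> \<open>The ratio in \<open>K\<close> is carried back to a side of a chosen
          triangle, whose ratios avoid \<open>K\<close>.\<close>
        have "x \<in> ratios M" using x unfolding M(4) ratios_scale[OF M(1)] .
        with sub[OF M(2,3)] True show False by blast
      qed
      then show ?thesis using line_in_group_iff[OF L x] True by blast
    next
      case False
      have "x \<noteq> 0" using False by auto
      then obtain k where k: "k \<in> exponents n" "\<xi> powi k = x" using ex_log by blast
      then have "k \<in> X" using False by (simp add: X_eq log_set_def)
      then obtain S where S: "S \<in> P" "k \<in> S" using P by (auto simp: partition_on_def)
      then obtain M where M: "M \<in> t S" "x \<in> ratios M"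
        using t(2)[OF S(1)] k by (auto simp: log_ratios_def log_set_def)
      obtain \<gamma> where \<gamma>: "\<gamma> \<noteq> 0" "L = (\<lambda>y. \<gamma> * y) ` M"
        using ratios_meet[OF line[OF S(1) M(1)] L M(2) x] .
      have "\<exists>!T. T \<in> B \<and> L \<in> T"
      proof (rule ex1I[of _ "act \<gamma> (t S)"])
        show "act \<gamma> (t S) \<in> B \<and> L \<in> act \<gamma> (t S)"
          using \<gamma> S M act_memI unfolding B_def by blast
      next
        fix T assume "T \<in> B \<and> L \<in> T"
        then have "T \<in> B" "L \<in> T" by simp_all
        from mem_B[OF this] obtain \<delta> S' M'
          where \<delta>: "\<delta> \<noteq> 0" "S' \<in> P" "M' \<in> t S'" "T = act \<delta> (t S')" "L = (\<lambda>y. \<delta> * y) ` M'"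
          by (elim exE conjE)
        \<comment> \<open>Uniqueness in three stages: the logarithm of \<open>x\<close> fixes the
          block, the disjoint ratio sets fix the side, and the trivial stabilizer of the side fixes
          the multiplier.\<close>
        have x': "x \<in> ratios M'" using x \<delta> by (simp add: ratios_scale)
        then have "k \<in> log_ratios (t S')" using k \<delta>(3) by (auto simp: log_ratios_def log_set_def)
        then have "k \<in> S'" using t(2)[OF \<delta>(2)] by simp
        then have S': "S' = S" using P S \<delta>(2) by (auto simp: partition_on_def disjoint_def)
        then have "M' = M" using t(1)[OF S(1)] \<delta>(3) M x' unfolding base_triangle_def by blast
        then have eq: "(\<lambda>y. \<gamma> * y) ` M = (\<lambda>y. \<delta> * y) ` M" using \<gamma> \<delta> by simp
        have "(\<lambda>y. (\<delta> / \<gamma>) * y) ` M = (\<lambda>y. inverse \<gamma> * y) ` (\<lambda>y. \<delta> * y) ` M"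
          by (simp add: image_image field_simps)
        also have "\<dots> = M" unfolding eq[symmetric] using \<gamma>(1) by (simp add: image_image flip: mult.assoc)
        finally have "\<delta> / \<gamma> = 1"
          using card_ratios_eq_6_iff[OF line[OF S(1) M(1)]] card6[OF S(1) M(1)] by blast
        then show "T = act \<gamma> (t S)" using \<delta>(4) S' by simp
      qed
      then show ?thesis using line_in_group_iff[OF L x] False by blast
    qed
  qed
  ultimately show ?thesis by blast
qed

section \<open>Blocks of exponents as triples of \<Gamma>-sets\<close>

definition triple :: "int set set \<Rightarrow> bool" where
  "triple t \<longleftrightarrow> card t = 3 \<and>
    (\<exists>k1\<in>X. \<exists>k2\<in>X. \<exists>k3\<in>X. t = {Gam n \<xi> k1, Gam n \<xi> k2, Gam n \<xi> k3} \<and>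
      (k1 + k2 + k3) mod (2 ^ n - 1) = 0)"

text \<open>The \<Gamma>-sets are equivalence classes, so the only ones inside a block are the three
  that compose it.\<close>

lemma block_imp_triple:
  assumes "block S"
  shows "triple {A \<in> Gam n \<xi> ` X. A \<subseteq> S} \<and> (\<forall>k\<in>X \<inter> S. Gam n \<xi> k \<subseteq> S \<and> card (Gam n \<xi> k) = 6)"
proof -
  obtain k1 k2 k3 where X: "k1 \<in> X" "k2 \<in> X" "k3 \<in> X"
    and S: "S = Gam n \<xi> k1 \<union> Gam n \<xi> k2 \<union> Gam n \<xi> k3" "card S = 18"
    and disj: "Gam n \<xi> k1 \<inter> Gam n \<xi> k2 = {}" "Gam n \<xi> k1 \<inter> Gam n \<xi> k3 = {}"
      "Gam n \<xi> k2 \<inter> Gam n \<xi> k3 = {}"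
    and sum: "(k1 + k2 + k3) mod (2 ^ n - 1) = 0"
    using assms by (rule blockE)
  have *: "Gam n \<xi> k \<in> {Gam n \<xi> k1, Gam n \<xi> k2, Gam n \<xi> k3}" if "k \<in> X" "k \<in> S" for k
    using that Gam_eqI[OF that(1) _ Gam_self[OF that(1)]] X unfolding S(1) by blast
  have eq: "{A \<in> Gam n \<xi> ` X. A \<subseteq> S} = {Gam n \<xi> k1, Gam n \<xi> k2, Gam n \<xi> k3}"
  proof (intro equalityI subsetI)
    fix A assume "A \<in> {A \<in> Gam n \<xi> ` X. A \<subseteq> S}"
    then obtain k where "A = Gam n \<xi> k" "k \<in> X" "k \<in> S" using Gam_self by blast
    with * show "A \<in> {Gam n \<xi> k1, Gam n \<xi> k2, Gam n \<xi> k3}" by blast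
  qed (use X S in blast)
  have ne: "Gam n \<xi> k1 \<noteq> Gam n \<xi> k2" "Gam n \<xi> k1 \<noteq> Gam n \<xi> k3" "Gam n \<xi> k2 \<noteq> Gam n \<xi> k3"
    using disj Gam_self X by blast+
  then have triple: "triple {A \<in> Gam n \<xi> ` X. A \<subseteq> S}"
    unfolding triple_def eq
    by (intro conjI bexI[of _ k1] bexI[of _ k2] bexI[of _ k3]) (simp_all add: X sum)
  have card: "card (Gam n \<xi> k1) = 6" "card (Gam n \<xi> k2) = 6" "card (Gam n \<xi> k3) = 6"
    using card_Un3_eq_18[OF S(2)[unfolded S(1)]] card_Gam_le X by blast+
  have "Gam n \<xi> k \<subseteq> S \<and> card (Gam n \<xi> k) = 6" if "k \<in> X \<inter> S" for k
  proof -
    from that have "Gam n \<xi> k \<in> {Gam n \<xi> k1, Gam n \<xi> k2, Gam n \<xi> k3}" by (intro *) simp_all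
    then consider "Gam n \<xi> k = Gam n \<xi> k1" | "Gam n \<xi> k = Gam n \<xi> k2" | "Gam n \<xi> k = Gam n \<xi> k3"
      by blast
    then show ?thesis by cases (use card S in auto)
  qed
  with triple show ?thesis by blast
qed

lemma triple_partition_if_block_partition:
  assumes P: "partition_on X P" and block: "\<forall>S\<in>P. block S"
  shows "(\<forall>k\<in>X. card (Gam n \<xi> k) = 6) \<and>
    (\<exists>Q. partition_on (Gam n \<xi> ` X) Q \<and> (\<forall>t\<in>Q. triple t))"
proof -
  \<comment> \<open>Described through \<open>S\<close> alone, so no choice of \<open>k1\<close>,
    \<open>k2\<close>, \<open>k3\<close> is needed.\<close>
  define f where "f S = {A \<in> Gam n \<xi> ` X. A \<subseteq> S}" for S
  have triple: "triple (f S)" if "S \<in> P" for S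
    using block block_imp_triple that unfolding f_def by blast
  have sub: "Gam n \<xi> k \<subseteq> S" and card: "card (Gam n \<xi> k) = 6" if "S \<in> P" "k \<in> X" "k \<in> S" for S k
    using block block_imp_triple that by blast+
  have cover: "\<exists>S\<in>P. k \<in> S" if "k \<in> X" for k using P that by (auto simp: partition_on_def)
  have "partition_on (Gam n \<xi> ` X) (f ` P)"
  proof (rule partition_onI)
    show "\<Union> (f ` P) = Gam n \<xi> ` X"
    proof
      show "Gam n \<xi> ` X \<subseteq> \<Union> (f ` P)"
      proof
        fix A assume A: "A \<in> Gam n \<xi> ` X"
        then obtain k where k: "k \<in> X" "A = Gam n \<xi> k" by blast
        then obtain S where S: "S \<in> P" "k \<in> S" using cover by blast
        then have "A \<in> f S" using sub[OF S(1) k(1) S(2)] A k(2) by (simp add: f_def)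
        with S show "A \<in> \<Union> (f ` P)" by blast
      qed
    qed (auto simp: f_def)
    show "disjnt t t'" if tt: "t \<in> f ` P" "t' \<in> f ` P" "t \<noteq> t'" for t t'
    proof (rule ccontr)
      assume "\<not> disjnt t t'"
      then obtain S S' k where S: "S \<in> P" "S' \<in> P" "t = f S" "t' = f S'" and k: "k \<in> X"
        "Gam n \<xi> k \<subseteq> S" "Gam n \<xi> k \<subseteq> S'"
        using tt unfolding disjnt_def f_def by blast
      then have "k \<in> S \<inter> S'" using Gam_self by blast
      then have "S = S'" using P S by (auto simp: partition_on_def disjoint_def)
      with S tt show False by simp
    qed
    show "{} \<notin> f ` P"
    proof
      assume "{} \<in> f ` P"
      then obtain S where "S \<in> P" "{} = f S" by (rule imageE)
      then have "triple {}" using triple[OF \<open>S \<in> P\<close>] by simp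
      then show False by (simp add: triple_def)
    qed
  qed
  then show ?thesis using triple card cover by blast
qed

text \<open>Take the union of each triple. Distinct \<Gamma>-sets are disjoint, but only the
  assumption of six elements makes the union have 18.\<close>

lemma block_partition_if_triple_partition:
  assumes card: "\<forall>k\<in>X. card (Gam n \<xi> k) = 6"
    and Q: "partition_on (Gam n \<xi> ` X) Q" and triple: "\<forall>t\<in>Q. triple t"
  shows "\<exists>P. partition_on X P \<and> (\<forall>S\<in>P. block S)"
proof (intro exI conjI)
  have disj: "A \<inter> A' = {}" if A: "A \<in> Gam n \<xi> ` X" "A' \<in> Gam n \<xi> ` X" "A \<noteq> A'" for A A'
  proof (rule ccontr)
    assume "A \<inter> A' \<noteq> {}"
    then obtain i where i: "i \<in> A" "i \<in> A'" by blast
    obtain k j where kj: "k \<in> X" "A = Gam n \<xi> k" "j \<in> X" "A' = Gam n \<xi> j" using A by blast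
    show False using Gam_eqI[OF kj(1,3) i[unfolded kj]] A(3) kj by simp
  qed
  have block: "block (\<Union>t)" if tQ: "t \<in> Q" for t
  proof -
    obtain k1 k2 k3 where k: "k1 \<in> X" "k2 \<in> X" "k3 \<in> X"
      and t: "t = {Gam n \<xi> k1, Gam n \<xi> k2, Gam n \<xi> k3}" "card t = 3"
      and sum: "(k1 + k2 + k3) mod (2 ^ n - 1) = 0"
      using triple[rule_format, OF tQ] unfolding triple_def by (elim conjE bexE)
    have "Gam n \<xi> k1 \<noteq> Gam n \<xi> k2" "Gam n \<xi> k1 \<noteq> Gam n \<xi> k3" "Gam n \<xi> k2 \<noteq> Gam n \<xi> k3"
      using t by (auto simp: card_insert_if split: if_splits)
    then have d: "Gam n \<xi> k1 \<inter> Gam n \<xi> k2 = {}" "Gam n \<xi> k1 \<inter> Gam n \<xi> k3 = {}"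
      "Gam n \<xi> k2 \<inter> Gam n \<xi> k3 = {}"
      using k by (simp_all add: disj)
    have U: "\<Union>t = Gam n \<xi> k1 \<union> Gam n \<xi> k2 \<union> Gam n \<xi> k3" unfolding t by auto
    moreover have "card (\<Union>t) = 18" unfolding U using card k d by (intro card_disjoint_18) auto
    ultimately show ?thesis using k d sum by (intro blockI)
  qed
  then show "\<forall>S\<in>Union ` Q. block S" by blast
  show "partition_on X (Union ` Q)"
  proof (rule partition_onI)
    have UQ: "\<Union>Q = Gam n \<xi> ` X" using Q by (simp add: partition_on_def)
    have "\<Union> (Union ` Q) = \<Union> (\<Union>Q)" by blast
    also have "\<dots> = X" unfolding UQ using Gam_self Gam_subset by blast
    finally show "\<Union> (Union ` Q) = X" .
    show "disjnt S S'" if SS: "S \<in> Union ` Q" "S' \<in> Union ` Q" "S \<noteq> S'" for S S'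
    proof (rule ccontr)
      assume "\<not> disjnt S S'"
      then obtain t t' A A' where t: "t \<in> Q" "t' \<in> Q" "S = \<Union>t" "S' = \<Union>t'"
        "A \<in> t" "A' \<in> t'" "A \<inter> A' \<noteq> {}"
        using SS unfolding disjnt_def by blast
      have "A \<in> Gam n \<xi> ` X" "A' \<in> Gam n \<xi> ` X"
        unfolding UQ[symmetric] by (rule UnionI[OF t(1,5)], rule UnionI[OF t(2,6)])
      then have "A = A'" using disj t(7) by metis
      then have "t = t'"
        using t(5,6) disjointD[OF partition_onD2[OF Q] t(1,2)] by blast
      with t SS show False by simp
    qed
    show "{} \<notin> Union ` Q"
    proof
      assume "{} \<in> Union ` Q"
      then obtain t where "t \<in> Q" "{} = \<Union>t" by (rule imageE)
      then have "block {}" using block[OF \<open>t \<in> Q\<close>] by (simp only:)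
      then show False by (simp add: block_def)
    qed
  qed
qed

end

theorem theorem2:
  fixes \<xi> :: "'a::{field,finite}" and n m :: nat and g :: int and X :: "int set"
  assumes "card (UNIV :: 'a set) = 2 ^ n"
    and "m dvd n"
    and "primitive_element \<xi>"
    and "g = (2 ^ n - 1) div (2 ^ m - 1)"
    and "X = exponents n - multiples n g"
  shows
    "((\<exists>B. gd_triangle_design f2_scale n m (UNIV :: 'a set) (desarguesian_spread m) B \<and>
           mult_invariant B)
      \<longleftrightarrow>
      (\<exists>P. partition_on X P \<and>
        (\<forall>S\<in>P. card S = 18 \<and>
          (\<exists>k1\<in>X. \<exists>k2\<in>X. \<exists>k3\<in>X.
             S = Gam n \<xi> k1 \<union> Gam n \<xi> k2 \<union> Gam n \<xi> k3 \<and>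
             Gam n \<xi> k1 \<inter> Gam n \<xi> k2 = {} \<and> Gam n \<xi> k1 \<inter> Gam n \<xi> k3 = {} \<and>
             Gam n \<xi> k2 \<inter> Gam n \<xi> k3 = {} \<and>
             (k1 + k2 + k3) mod (2 ^ n - 1) = 0))))
     \<and>
     ((\<exists>P. partition_on X P \<and>
        (\<forall>S\<in>P. card S = 18 \<and>
          (\<exists>k1\<in>X. \<exists>k2\<in>X. \<exists>k3\<in>X.
             S = Gam n \<xi> k1 \<union> Gam n \<xi> k2 \<union> Gam n \<xi> k3 \<and>
             Gam n \<xi> k1 \<inter> Gam n \<xi> k2 = {} \<and> Gam n \<xi> k1 \<inter> Gam n \<xi> k3 = {} \<and>
             Gam n \<xi> k2 \<inter> Gam n \<xi> k3 = {} \<and>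
             (k1 + k2 + k3) mod (2 ^ n - 1) = 0)))
      \<longleftrightarrow>
      (\<forall>k\<in>X. card (Gam n \<xi> k) = 6) \<and>
      (\<exists>Q. partition_on (Gam n \<xi> ` X) Q \<and>
        (\<forall>t\<in>Q. card t = 3 \<and>
          (\<exists>k1\<in>X. \<exists>k2\<in>X. \<exists>k3\<in>X.
             t = {Gam n \<xi> k1, Gam n \<xi> k2, Gam n \<xi> k3} \<and>
             (k1 + k2 + k3) mod (2 ^ n - 1) = 0))))
     \<and>
     (\<forall>B. gd_triangle_design f2_scale n m (UNIV :: 'a set) (desarguesian_spread m) B \<and>
           mult_invariant B
        \<longrightarrow> balanced (UNIV :: 'a set) B)"
proof -
  interpret S: spread \<xi> n m g
    by unfold_locales (use assms in auto)
  have X: "X = S.X" using assms unfolding S.X_def by blast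
  \<comment> \<open>The definitions \<open>design\<close>, \<open>block\<close> and
    \<open>triple\<close> repeat subformulas of the statement, so folding them reduces it to the
    lemmas above.\<close>
  show ?thesis
    unfolding X S.design_def[symmetric] S.block_def[symmetric] S.triple_def[symmetric]
  proof (intro conjI iffI allI impI)
    assume "\<exists>B. S.design B \<and> mult_invariant B"
    then obtain B where "S.design B" "mult_invariant B" by (elim exE conjE)
    then show "\<exists>P. partition_on S.X P \<and> (\<forall>S\<in>P. S.block S)"
      by (intro exI) (rule S.design_block_partition)
  next
    assume "\<exists>P. partition_on S.X P \<and> (\<forall>S\<in>P. S.block S)"
    then obtain P where "partition_on S.X P" "\<forall>S\<in>P. S.block S" by (elim exE conjE)
    then show "\<exists>B. S.design B \<and> mult_invariant B" by (rule S.block_partition_design)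
  next
    assume "\<exists>P. partition_on S.X P \<and> (\<forall>S\<in>P. S.block S)"
    then obtain P where P: "partition_on S.X P" "\<forall>S\<in>P. S.block S" by (elim exE conjE)
    note S.triple_partition_if_block_partition[OF P]
    then show "\<forall>k\<in>S.X. card (Gam n \<xi> k) = 6"
      "\<exists>Q. partition_on (Gam n \<xi> ` S.X) Q \<and> (\<forall>t\<in>Q. S.triple t)"
      by (rule conjunct1, rule conjunct2)
  next
    assume "(\<forall>k\<in>S.X. card (Gam n \<xi> k) = 6) \<and>
      (\<exists>Q. partition_on (Gam n \<xi> ` S.X) Q \<and> (\<forall>t\<in>Q. S.triple t))"
    then obtain Q where "\<forall>k\<in>S.X. card (Gam n \<xi> k) = 6"
      "partition_on (Gam n \<xi> ` S.X) Q" "\<forall>t\<in>Q. S.triple t" by (elim exE conjE)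
    then show "\<exists>P. partition_on S.X P \<and> (\<forall>S\<in>P. S.block S)"
      by (rule S.block_partition_if_triple_partition)
  next
    fix B assume "S.design B \<and> mult_invariant B"
    then show "balanced UNIV B" by (intro balanced_if_mult_invariant) (rule conjunct2)
  qed
qed

end
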